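(* Let $F$ be the free group with basis $x_1,\ldots,x_n$, let $r\in F$, and let $R$ be the normal subgroup generated in $F$ by the element $r$. Then the condition "$r$ is a cyclically reduced word in the generators $x_1,\ldots,x_n$ containing $x_n$" is equivalent to the condition $$D_n(r)\not\equiv 0 \mod \mathbf{Z}[F]\cdot(R-1),$$ where $D_n$ is the Fox derivative of the ring $\mathbf{Z}[F]$ uniquely determined by the conditions $D_n(x_n)=1$ and $D_n(x_j)=0$ for $j\neq n$.
   Context: $\mathbf{Z}[F]$ is the integral group ring of $F$ and $\varepsilon:\mathbf{Z}[F]\to\mathbf{Z}$ is the augmentation (the trivialization $F\to 1$ extended by linearity). The Fox derivative $D_n:\mathbf{Z}[F]\to\mathbf{Z}[F]$ is a derivation in the sense that $D_n(u+v)=D_n(u)+D_n(v)$ and $D_n(uv)=D_n(u)v+\varepsilon(u)D_n(v)$ for all $u,v\in\mathbf{Z}[F]$. $\mathbf{Z}[F]\cdot(R-1)$ is the ideal of $\mathbf{Z}[F]$ consisting of all finite sums of elements $u(h-1)$ with $u\in\mathbf{Z}[F]$, $h\in R$.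
   Formalization: The equivalence fails for r = x_1 x_2 x_1^{-1} (n = 2), which is not cyclically reduced. Proved instead: the equivalence for r given by a cyclically reduced word and, for every r, the equivalence with "r is conjugate to a cyclically reduced word containing x_n". *)

theory Defs
  imports Main "HOL-Library.Poly_Mapping"
begin

section \<open>Words\<close>

text \<open>The letter \<open>(a, True)\<close> stands for the generator \<open>a\<close>, and \<open>(a, False)\<close> for its inverse.\<close>

type_synonym 'a letter = "'a \<times> bool"

definition inv_letter :: "'a letter \<Rightarrow> 'a letter" where
  "inv_letter p = (fst p, \<not> snd p)"

definition reduced :: "'a letter list \<Rightarrow> bool" where
  "reduced w \<longleftrightarrow> successively (\<lambda>p q. q \<noteq> inv_letter p) w"

definition cyclically_reduced :: "'a letter list \<Rightarrow> bool" where
  "cyclically_reduced w \<longleftrightarrow> reduced w \<and> (w \<noteq> [] \<longrightarrow> hd w \<noteq> inv_letter (last w))"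

definition occurs_in :: "'a \<Rightarrow> 'a letter list \<Rightarrow> bool" where
  "occurs_in a w \<longleftrightarrow> a \<in> fst ` set w"

section \<open>The free group on a type of generators\<close>

inductive cancels :: "'a letter list \<Rightarrow> 'a letter list \<Rightarrow> bool" where
  "cancels (u @ [p, inv_letter p] @ v) (u @ v)"

quotient_type 'a free_group = "'a letter list" / "equivclp cancels"
  morphisms rep_free_group word_elem
  by (rule equivp_evquivclp)

lemma inv_letter_inv_letter [simp]: "inv_letter (inv_letter p) = p"
  by (simp add: inv_letter_def)

lemma equivclp_map:
  assumes "equivclp R a b" and "\<And>x y. R x y \<Longrightarrow> equivclp S (f x) (f y)"
  shows "equivclp S (f a) (f b)"
  using assms(1)
proof (induction rule: equivclp_induct)
  case base
  then show ?case by simp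
next
  case (step y z)
  then show ?case by (meson assms(2) equivclp_sym equivclp_trans)
qed

lemma cancels_append_right: "cancels u v \<Longrightarrow> cancels (u @ w) (v @ w)"
  by (metis append.assoc cancels.simps)

lemma cancels_append_left: "cancels u v \<Longrightarrow> cancels (w @ u) (w @ v)"
  by (metis append.assoc cancels.simps)

lemma cancels_inverse:
  assumes "cancels u v"
  shows "cancels (rev (map inv_letter u)) (rev (map inv_letter v))"
  using assms
proof cases
  case (1 s p t)
  then show ?thesis
    using cancels.intros[of "rev (map inv_letter t)" p "rev (map inv_letter s)"] by simp
qed

text \<open>
  The group operation is written additively, although it is not commutative: this is the notation
  of the type class \<^class>\<open>group_add\<close>, for which finitely supported functions
  \<open>'g \<Rightarrow>\<^sub>0 int\<close> form, under convolution, the integral group ring.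
\<close>

instantiation free_group :: (type) group_add
begin

lift_definition zero_free_group :: "'a free_group" is "[]" .

lift_definition plus_free_group :: "'a free_group \<Rightarrow> 'a free_group \<Rightarrow> 'a free_group" is "(@)"
proof -
  fix u u' v v' :: "'a letter list"
  assume u: "equivclp cancels u u'" and v: "equivclp cancels v v'"
  have "equivclp cancels (u @ v) (u' @ v)"
    using u by (rule equivclp_map) (blast intro: cancels_append_right)
  also have "equivclp cancels (u' @ v) (u' @ v')"
    using v by (rule equivclp_map) (blast intro: cancels_append_left)
  finally (equivclp_trans) show "equivclp cancels (u @ v) (u' @ v')" .
qed

lift_definition uminus_free_group :: "'a free_group \<Rightarrow> 'a free_group"
  is "\<lambda>w. rev (map inv_letter w)"
  by (erule equivclp_map) (blast intro: cancels_inverse)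

definition minus_free_group :: "'a free_group \<Rightarrow> 'a free_group \<Rightarrow> 'a free_group" where
  "minus_free_group g h = g + - h"

instance
proof
  fix g h k :: "'a free_group"
  show "g + h + k = g + (h + k)" by transfer simp
  show "0 + g = g" by transfer simp
  show "g + 0 = g" by transfer simp
  show "- g + g = 0"
  proof transfer
    fix w :: "'a letter list"
    show "equivclp cancels (rev (map inv_letter w) @ w) []"
    proof (induction w)
      case Nil
      then show ?case by simp
    next
      case (Cons p w)
      have "equivclp cancels (rev (map inv_letter (p # w)) @ p # w) (rev (map inv_letter w) @ w)"
        using cancels.intros[of "rev (map inv_letter w)" "inv_letter p" w]
        by (simp add: r_into_equivclp)
      then show ?case using Cons by (rule equivclp_trans)
    qed
  qed
  show "g + - h = g - h" by (simp add: minus_free_group_def)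
qed

end

definition gen :: "'a \<Rightarrow> 'a free_group" where
  "gen a = word_elem [(a, True)]"

inductive_set normal_closure :: "'g::group_add set \<Rightarrow> 'g set" for S where
  base: "h \<in> S \<Longrightarrow> h \<in> normal_closure S"
| zero: "0 \<in> normal_closure S"
| add: "h \<in> normal_closure S \<Longrightarrow> k \<in> normal_closure S \<Longrightarrow> h + k \<in> normal_closure S"
| uminus: "h \<in> normal_closure S \<Longrightarrow> - h \<in> normal_closure S"
| conjugate: "h \<in> normal_closure S \<Longrightarrow> g + h - g \<in> normal_closure S"

section \<open>The integral group ring and Fox derivatives\<close>

text \<open>\<open>frag_of g\<close> is the group element \<open>g\<close> regarded as an element of the group ring.\<close>

definition augmentation :: "('g \<Rightarrow>\<^sub>0 int) \<Rightarrow> int" where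
  "augmentation u = (\<Sum>g\<in>Poly_Mapping.keys u. Poly_Mapping.lookup u g)"

definition fox_derivation :: "(('g::group_add \<Rightarrow>\<^sub>0 int) \<Rightarrow> ('g \<Rightarrow>\<^sub>0 int)) \<Rightarrow> bool" where
  "fox_derivation D \<longleftrightarrow>
     (\<forall>u v. D (u + v) = D u + D v) \<and>
     (\<forall>u v. D (u * v) = D u * v + of_int (augmentation u) * D v)"

definition fox_derivative :: "'a \<Rightarrow> ('a free_group \<Rightarrow>\<^sub>0 int) \<Rightarrow> ('a free_group \<Rightarrow>\<^sub>0 int)" where
  "fox_derivative a =
     (THE D. fox_derivation D \<and> D (frag_of (gen a)) = 1 \<and>
             (\<forall>b. b \<noteq> a \<longrightarrow> D (frag_of (gen b)) = 0))"

text \<open>The ideal \<open>\<int>[G] \<cdot> (R - 1)\<close> for a normal subgroup \<open>R\<close> of \<open>G\<close>.\<close>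

definition relative_augmentation_ideal :: "'g::group_add set \<Rightarrow> ('g \<Rightarrow>\<^sub>0 int) set" where
  "relative_augmentation_ideal R =
     {\<Sum>i<k. u i * (frag_of (h i) - 1) | (k::nat) u h. \<forall>i<k. h i \<in> R}"

end

theory Submission
  imports Defs "HOL-Library.Countable_Set"
begin

text \<open>
  Let \<open>w\<close> be a cyclically reduced word for \<open>r\<close> and \<open>a = x\<^sub>n\<close>. The Fox derivative of \<open>r\<close> with respect to
  \<open>a\<close> is a signed sum of suffixes of \<open>w\<close>, one for each occurrence of \<open>a\<close> (positive) or \<open>a\<^bsup>-1\<^esup>\<close>
  (negative). It is \<open>0\<close> if \<open>a\<close> does not occur. The ideal consists of elements that vanish in
  \<open>\<int>[F/R]\<close>. There two terms of opposite sign can cancel only if two suffixes agree modulo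
  \<open>R\<close>, that is, if the subword between their starting points lies in \<open>R\<close>. By Weinbaum's theorem no
  nonempty proper subword of \<open>w\<close> lies in \<open>R\<close>, and the two remaining possibilities contradict cyclic
  reducedness (\<open>fox_terms_opposite_signs\<close>). So if \<open>a\<close> occurs, nothing cancels and the derivative is
  nonzero modulo the ideal. Every element is conjugate to one given by a cyclically reduced word, and
  conjugating \<open>r\<close> multiplies its derivative modulo the ideal by a unit, which gives the statement
  about conjugates.

  Weinbaum's theorem is proved together with Magnus' Freiheitssatz by Magnus' induction on the
  length of the relator. A relator in a single generator is a power, for which both are immediate.
  Otherwise, choose weights of the generators for which \<open>r\<close> has weight \<open>0\<close> and some generator
  \<open>b\<close> occurring in \<open>r\<close> has nonzero weight. Regarding \<open>b\<close> as a power of a letter \<open>t\<close>, rewrite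
  words of weight \<open>0\<close> as words in the \<open>t\<close>-conjugates of the other letters (\<open>lift_word\<close>).
  This turns \<open>r\<close> into a shorter cyclically reduced word \<open>s\<close>, and subwords of \<open>r\<close> into subwords of \<open>s\<close>.
  Both theorems for \<open>r\<close> follow from those for \<open>s\<close>, provided that words that are trivial modulo \<open>r\<close>
  are rewritten to words that are trivial modulo \<open>s\<close> (\<open>lift_word_normal_closure\<close>). Classically this
  holds because the group of \<open>r\<close> embeds in an HNN extension with the group of \<open>s\<close> as base. Here the stable
  letter is found directly as a permutation: the Freiheitssatz for \<open>s\<close> makes the two associated
  subgroups free, they act freely with infinitely many orbits on a countable set, and any two such
  actions of one group are conjugate (\<open>free_actions_conjugate\<close>).
\<close>

section \<open>Reduced words\<close>

lemma word_elem_eq_iff: "word_elem u = word_elem v \<longleftrightarrow> equivclp cancels u v"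
  by (meson free_group.abs_eq_iff)

lemma word_elem_append: "word_elem (u @ v) = word_elem u + word_elem v"
  by (simp add: plus_free_group.abs_eq)

lemma word_elem_Nil [simp]: "word_elem [] = 0"
  by (simp add: zero_free_group_def)

lemma word_elem_Cons: "word_elem (p # v) = word_elem [p] + word_elem v"
  using word_elem_append[of "[p]" v] by simp

lemma word_elem_inv_letter: "word_elem [inv_letter p] = - word_elem [p]"
  by (simp add: uminus_free_group.abs_eq)

lemma word_elem_surj: "\<exists>w. g = word_elem w"
  by (induction g rule: free_group.abs_induct) blast

lemma inv_letter_neq [simp]: "inv_letter p \<noteq> p" "p \<noteq> inv_letter p"
  by (auto simp: inv_letter_def prod_eq_iff)

lemma fst_inv_letter [simp]: "fst (inv_letter p) = fst p"
  by (simp add: inv_letter_def)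

lemma reduced_Nil [simp]: "reduced []"
  by (simp add: reduced_def)

lemma reduced_Cons:
  "reduced (p # w) \<longleftrightarrow> (w \<noteq> [] \<longrightarrow> hd w \<noteq> inv_letter p) \<and> reduced w"
  by (cases w) (auto simp: reduced_def)

lemma reduced_append:
  "reduced (u @ v) \<longleftrightarrow>
     reduced u \<and> reduced v \<and> (u \<noteq> [] \<longrightarrow> v \<noteq> [] \<longrightarrow> hd v \<noteq> inv_letter (last u))"
  by (auto simp: reduced_def successively_append_iff)

lemma cyclically_reduced_iff: "cyclically_reduced w \<longleftrightarrow> reduced (w @ w)"
  by (auto simp: cyclically_reduced_def reduced_append)

lemma not_reducedE:
  assumes "\<not> reduced w"
  obtains u p v where "w = u @ [p, inv_letter p] @ v"
proof -
  have "\<exists>u p v. w = u @ [p, inv_letter p] @ v"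
    using assms
  proof (induction w)
    case (Cons p w)
    show ?case
    proof (cases "reduced w")
      case True
      then have "w \<noteq> []" "hd w = inv_letter p"
        using Cons.prems by (auto simp: reduced_Cons)
      then have "p # w = [] @ [p, inv_letter p] @ tl w"
        by (metis append_Cons append_Nil list.collapse)
      then show ?thesis by blast
    next
      case False
      then show ?thesis using Cons.IH by (metis append_Cons)
    qed
  qed simp
  then show ?thesis using that by blast
qed

lemma word_elem_cancel: "word_elem (u @ [p, inv_letter p] @ v) = word_elem (u @ v)"
  by (metis cancels.intros r_into_equivclp word_elem_eq_iff)

lemma reduced_representative:
  "\<exists>w'. reduced w' \<and> set w' \<subseteq> set w \<and> word_elem w' = word_elem w"
proof (induction "length w" arbitrary: w rule: less_induct)
  case less
  show ?case
  proof (cases "reduced w")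
    case False
    then obtain u p v where w: "w = u @ [p, inv_letter p] @ v"
      by (rule not_reducedE)
    from less[of "u @ v"] w obtain w' where
      "reduced w'" "set w' \<subseteq> set (u @ v)" "word_elem w' = word_elem (u @ v)"
      by auto
    then show ?thesis using w word_elem_cancel[of u p v] by fastforce
  qed blast
qed

lemma cyclically_reduced_conjugate:
  "\<exists>w g. cyclically_reduced w \<and> word_elem v = g + word_elem w - g"
proof (induction "length v" arbitrary: v rule: less_induct)
  case less
  show ?case
  proof (cases "cyclically_reduced v")
    case True
    then have "cyclically_reduced v \<and> word_elem v = 0 + word_elem v - 0" by simp
    then show ?thesis by blast
  next
    case False
    show ?thesis
    proof (cases "reduced v")
      case False
      then obtain u p v' where v: "v = u @ [p, inv_letter p] @ v'"
        by (rule not_reducedE)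
      show ?thesis
        using less[of "u @ v'"] unfolding v word_elem_cancel by simp
    next
      case True
      with \<open>\<not> cyclically_reduced v\<close> have "v \<noteq> []" and hd: "hd v = inv_letter (last v)"
        by (auto simp: cyclically_reduced_def)
      then obtain p v1 where v1: "v = p # v1" by (cases v) auto
      with hd have "v1 \<noteq> []" by auto
      then obtain v2 q where v2: "v1 = v2 @ [q]" by (metis rev_exhaust)
      have v: "v = p # v2 @ [inv_letter p]" using hd v1 v2 by auto
      obtain w g where w: "cyclically_reduced w" "word_elem v2 = g + word_elem w - g"
        using less[of v2] v by auto
      have "word_elem v = word_elem [p] + word_elem v2 + - word_elem [p]"
        unfolding v by (subst word_elem_Cons) (simp only: word_elem_append word_elem_inv_letter add.assoc)
      also have "\<dots> = (word_elem [p] + g) + word_elem w - (word_elem [p] + g)"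
        by (simp only: w(2) diff_conv_add_uminus minus_add add.assoc)
      finally show ?thesis using w(1) by blast
    qed
  qed
qed

definition push_letter :: "'a letter \<Rightarrow> 'a letter list \<Rightarrow> 'a letter list" where
  "push_letter p w = (if w \<noteq> [] \<and> hd w = inv_letter p then tl w else p # w)"

lemma reduced_push_letter: "reduced w \<Longrightarrow> reduced (push_letter p w)"
  by (cases w) (auto simp: push_letter_def reduced_Cons)

lemma push_letter_inv_letter:
  "reduced w \<Longrightarrow> push_letter p (push_letter (inv_letter p) w) = w"
  by (cases w) (auto simp: push_letter_def reduced_Cons)

text \<open>Letting the letters of a word act on reduced words by multiplication with cancellation respects
  the defining relation of the free group, and a reduced word acting on the empty word returns
  itself. So a nonempty reduced word cannot be trivial.\<close>

lemma word_elem_reduced_eq_0_iff: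
  assumes "reduced w"
  shows "word_elem w = 0 \<longleftrightarrow> w = []"
proof
  define nf where "nf = (\<lambda>u :: 'a letter list. foldr push_letter u [])"
  have red: "reduced (foldr push_letter u v)" if "reduced v" for u v :: "'a letter list"
    using that by (induction u) (auto intro: reduced_push_letter)
  have "nf u = nf v" if "cancels u v" for u v
    using that
    by cases (simp add: nf_def push_letter_inv_letter red)
  then have inv: "nf u = nf v" if "equivclp cancels u v" for u v
    by (use that in \<open>induction rule: equivclp_induct\<close>) (auto dest: \<open>\<And>u v. cancels u v \<Longrightarrow> nf u = nf v\<close>)
  have "nf w = w"
    using assms
    by (induction w) (auto simp: nf_def push_letter_def reduced_Cons)
  moreover assume "word_elem w = 0"
  then have "equivclp cancels w []"
    by (metis word_elem_Nil word_elem_eq_iff)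
  then have "nf w = []" using inv by (force simp: nf_def)
  ultimately show "w = []" by simp
qed simp

section \<open>Homomorphisms out of a free group\<close>

definition letter_val :: "('a \<Rightarrow> 'g::group_add) \<Rightarrow> 'a letter \<Rightarrow> 'g" where
  "letter_val f p = (if snd p then f (fst p) else - f (fst p))"

definition word_val :: "('a \<Rightarrow> 'g::group_add) \<Rightarrow> 'a letter list \<Rightarrow> 'g" where
  "word_val f w = sum_list (map (letter_val f) w)"

lemma word_val_simps [simp]:
  "word_val f [] = 0" "word_val f (p # w) = letter_val f p + word_val f w"
  "word_val f (u @ v) = word_val f u + word_val f v"
  by (simp_all add: word_val_def)

lemma letter_val_inv_letter [simp]: "letter_val f (inv_letter p) = - letter_val f p"
  by (simp add: letter_val_def inv_letter_def)

lift_definition free_hom :: "('a \<Rightarrow> 'g::group_add) \<Rightarrow> 'a free_group \<Rightarrow> 'g" is word_val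
proof -
  fix f :: "'a \<Rightarrow> 'g" and u v :: "'a letter list"
  have step: "word_val f u = word_val f v" if "cancels u v" for u v
    using that by cases (simp add: add.assoc[symmetric])
  assume "equivclp cancels u v"
  then show "word_val f u = word_val f v"
    by (induction rule: equivclp_induct) (auto dest: step)
qed

lemma free_hom_word_elem: "free_hom f (word_elem w) = word_val f w"
  by (rule free_hom.abs_eq)

lemma free_hom_add: "free_hom f (g + h) = free_hom f g + free_hom f h"
  by transfer simp

lemma free_hom_zero [simp]: "free_hom f 0 = 0"
  by transfer simp

lemma free_hom_uminus: "free_hom f (- g) = - free_hom f g"
  by (metis add_eq_0_iff2 free_hom_add free_hom_zero neg_eq_iff_add_eq_0)

lemma word_elem_letter: "word_elem [p] = letter_val gen p"
proof (cases "snd p")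
  case True
  then have "p = (fst p, True)" by (metis prod.collapse)
  then show ?thesis by (metis gen_def letter_val_def True)
next
  case False
  then have "p = inv_letter (fst p, True)" by (simp add: inv_letter_def prod_eq_iff)
  then show ?thesis by (metis gen_def letter_val_def False word_elem_inv_letter)
qed

lemma free_hom_gen [simp]: "free_hom f (gen a) = f a"
  by (simp add: gen_def free_hom_word_elem letter_val_def)

definition map_word :: "('a \<Rightarrow> 'b) \<Rightarrow> 'a letter list \<Rightarrow> 'b letter list" where
  "map_word f = map (map_prod f id)"

lemma word_val_gen: "word_val (\<lambda>a. gen (f a)) w = word_elem (map_word f w)"
proof (induction w)
  case (Cons p w)
  show ?case
    by (simp add: map_word_def, subst word_elem_Cons, subst word_elem_letter)
       (use Cons in \<open>simp add: map_word_def letter_val_def\<close>)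
qed (simp add: map_word_def)

lemma word_elem_conv_word_val: "word_elem w = word_val gen w"
  using word_val_gen[of "\<lambda>a. a" w] by (simp add: map_word_def prod.map_ident id_def)

lemma map_word_simps [simp]:
  "map_word f [] = []" "map_word f (u @ v) = map_word f u @ map_word f v"
  "map_word f w = [] \<longleftrightarrow> w = []"
  by (simp_all add: map_word_def)

lemma map_prod_inv_letter: "map_prod f id (inv_letter p) = inv_letter (map_prod f id p)"
  by (cases p) (simp add: inv_letter_def)

lemma reduced_map_word:
  assumes "inj f"
  shows "reduced (map_word f w) \<longleftrightarrow> reduced w"
proof -
  have inj: "inj (map_prod f (id :: bool \<Rightarrow> bool))"
    using assms by (simp add: prod.inj_map)
  show ?thesis
    unfolding reduced_def map_word_def successively_map map_prod_inv_letter[symmetric] inj_eq[OF inj] ..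
qed

lemma cyclically_reduced_map_word:
  "inj f \<Longrightarrow> cyclically_reduced (map_word f w) \<longleftrightarrow> cyclically_reduced w"
  using reduced_map_word[of f "w @ w"] by (simp add: cyclically_reduced_iff)

lemma fst_set_map_word: "fst ` set (map_word f w) = f ` fst ` set w"
  by (force simp: map_word_def)

lemma occurs_in_map_word:
  "inj f \<Longrightarrow> occurs_in (f a) (map_word f w) \<longleftrightarrow> occurs_in a w"
  by (simp add: occurs_in_def fst_set_map_word inj_image_mem_iff)

section \<open>Normal closures and their cosets\<close>

lemmas group_normalize =
  diff_conv_add_uminus minus_add add.assoc minus_minus add_minus_cancel minus_add_cancel
  right_minus left_minus add_0_left add_0_right minus_zero

lemma group_hom_zero:
  fixes f :: "'g::group_add \<Rightarrow> 'h::group_add"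
  assumes "\<And>g h. f (g + h) = f g + f h"
  shows "f 0 = 0"
proof -
  have "f 0 + f 0 = f 0 + 0" by (simp only: assms[symmetric] add_0_right)
  then show ?thesis by (rule add_left_imp_eq)
qed

lemma group_hom_uminus:
  fixes f :: "'g::group_add \<Rightarrow> 'h::group_add"
  assumes "\<And>g h. f (g + h) = f g + f h"
  shows "f (- g) = - f g"
  using assms[of "- g" g] group_hom_zero[of f, OF assms] by (simp add: eq_neg_iff_add_eq_0)

lemma normal_closure_hom:
  assumes add: "\<And>g h. \<phi> (g + h) = \<phi> g + \<phi> h"
    and "\<And>g. g \<in> S \<Longrightarrow> \<phi> g \<in> normal_closure T"
    and g: "g \<in> normal_closure S"
  shows "\<phi> g \<in> normal_closure T"
proof -
  note z = group_hom_zero[of \<phi>, OF add] and u = group_hom_uminus[of \<phi>, OF add]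
  show ?thesis
    using g
  proof induction
    case (conjugate h g)
    then show ?case
      using normal_closure.conjugate[of "\<phi> h" T "\<phi> g"]
      by (simp only: diff_conv_add_uminus add u)
  qed (auto simp: assms z u intro: normal_closure.intros)
qed

lemma free_hom_normal_closure:
  assumes "g \<in> normal_closure {word_elem r}" and "word_val f r = 0"
  shows "free_hom f g = 0"
proof -
  have "free_hom f g \<in> normal_closure {}"
    by (rule normal_closure_hom[OF _ _ assms(1)])
       (auto simp: free_hom_add free_hom_word_elem assms(2) intro: normal_closure.zero)
  moreover have "h = 0" if "h \<in> normal_closure ({} :: 'b set)" for h
    using that by induction auto
  ultimately show ?thesis by blast
qed

lemma normal_closure_conjugate: "normal_closure {g + h - g} = normal_closure {h}"
proof
  have "h \<in> normal_closure {g + h - g}"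
    using normal_closure.conjugate[OF normal_closure.base[of "g + h - g" "{g + h - g}"], of "- g"]
    by (simp only: group_normalize singleton_iff simp_thms)
  then show "normal_closure {h} \<subseteq> normal_closure {g + h - g}"
    by (auto intro: normal_closure_hom[of "\<lambda>k. k" "{h}"])
  have "g + h - g \<in> normal_closure {h}"
    by (intro normal_closure.conjugate normal_closure.base) simp
  then show "normal_closure {g + h - g} \<subseteq> normal_closure {h}"
    by (auto intro: normal_closure_hom[of "\<lambda>k. k" "{g + h - g}"])
qed

definition left_coset :: "'g::group_add set \<Rightarrow> 'g \<Rightarrow> 'g set" where
  "left_coset N g = {h. - g + h \<in> N}"

lemma left_coset_eq_iff:
  "left_coset (normal_closure S) g = left_coset (normal_closure S) h \<longleftrightarrow> - g + h \<in> normal_closure S"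
    (is "?L = ?R \<longleftrightarrow> _")
proof
  assume eq: "?L = ?R"
  have "h \<in> ?L" unfolding eq by (simp add: left_coset_def normal_closure.zero)
  then show "- g + h \<in> normal_closure S" by (simp add: left_coset_def)
next
  assume gh: "- g + h \<in> normal_closure S"
  have "- g + k \<in> normal_closure S \<longleftrightarrow> - h + k \<in> normal_closure S" for k
  proof
    assume "- g + k \<in> normal_closure S"
    from normal_closure.add[OF normal_closure.uminus[OF gh] this]
    show "- h + k \<in> normal_closure S" by (simp only: group_normalize)
  next
    assume "- h + k \<in> normal_closure S"
    from normal_closure.add[OF gh this] show "- g + k \<in> normal_closure S" by (simp only: group_normalize)
  qed
  then show "?L = ?R" by (simp add: left_coset_def)
qed

section \<open>Permutations and free actions\<close>

typedef 'a permutation = "{f :: 'a \<Rightarrow> 'a. bij f}"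
  morphisms apply_perm Perm
  by (rule exI[of _ id]) simp

setup_lifting type_definition_permutation

instantiation permutation :: (type) group_add
begin

lift_definition zero_permutation :: "'a permutation" is id by simp
lift_definition plus_permutation :: "'a permutation \<Rightarrow> 'a permutation \<Rightarrow> 'a permutation"
  is "(\<circ>)" by (simp add: bij_comp)
lift_definition uminus_permutation :: "'a permutation \<Rightarrow> 'a permutation" is inv
  by (simp add: bij_imp_bij_inv)
definition minus_permutation :: "'a permutation \<Rightarrow> 'a permutation \<Rightarrow> 'a permutation" where
  "minus_permutation f g = f + - g"

instance
proof
  fix f g h :: "'a permutation"
  show "f + g + h = f + (g + h)" by transfer (simp add: comp_assoc)
  show "0 + f = f" "f + 0 = f" by (transfer, simp)+
  show "- f + f = 0" by transfer (simp add: bij_is_inj)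
  show "f + - g = f - g" by (simp add: minus_permutation_def)
qed

end

lemma apply_perm_zero [simp]: "apply_perm 0 i = i"
  by transfer simp

lemma apply_perm_add [simp]: "apply_perm (f + g) i = apply_perm f (apply_perm g i)"
  by transfer simp

lemma permutation_eqI: "(\<And>i. apply_perm f i = apply_perm g i) \<Longrightarrow> f = g"
  by transfer auto

instance free_group :: (countable) countable
proof
  define f :: "'a free_group \<Rightarrow> nat" where "f = (\<lambda>g. to_nat (SOME w. g = word_elem w))"
  have "g = word_elem (SOME w. g = word_elem w)" for g :: "'a free_group"
    using someI_ex[OF word_elem_surj] .
  then have "inj f" unfolding f_def by (intro injI) (metis from_nat_to_nat)
  then show "\<exists>f :: 'a free_group \<Rightarrow> nat. inj f" by blast
qed

text \<open>The permutations come from left translation on \<open>G/N \<times> \<nat>\<close>, a countably infinite set, which is then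
  numbered. The factor \<open>\<nat>\<close> is fixed by the action. Its coordinate \<open>\<kappa>\<close> takes every value, so
  every subgroup has infinitely many orbits; this makes free actions of subgroups comparable.\<close>

lemma regular_action:
  fixes S :: "'g::{group_add,countable} set"
  obtains \<alpha> :: "'g \<Rightarrow> nat permutation" and \<kappa> :: "nat \<Rightarrow> nat"
  where "\<And>g h. \<alpha> (g + h) = \<alpha> g + \<alpha> h"
    and "\<And>g i. apply_perm (\<alpha> g) i = i \<longleftrightarrow> g \<in> normal_closure S"
    and "\<And>g i. \<kappa> (apply_perm (\<alpha> g) i) = \<kappa> i" and "surj \<kappa>"
proof -
  define N where "N = normal_closure S"
  have conj: "g + h - g \<in> N" if "h \<in> N" for g h
    using that unfolding N_def by (rule normal_closure.conjugate)
  \<comment> \<open>a numbering of the cosets\<close>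
  define q where "q = (\<lambda>g. to_nat (SOME h. h \<in> left_coset N g))"
  have q_eq: "q g = q h \<longleftrightarrow> - g + h \<in> N" for g h
  proof
    have some: "(SOME h. h \<in> left_coset N g) \<in> left_coset N g" for g
      by (rule someI[of _ g]) (simp add: left_coset_def N_def normal_closure.zero)
    assume "q g = q h"
    then have eq: "(SOME k. k \<in> left_coset N g) = (SOME k. k \<in> left_coset N h)"
      by (simp add: q_def)
    let ?k = "SOME k. k \<in> left_coset N h"
    have "- g + ?k \<in> N" "- h + ?k \<in> N"
      using some[of g] some[of h] unfolding eq by (simp_all add: left_coset_def)
    then have "left_coset N g = left_coset N h"
      unfolding N_def left_coset_eq_iff[symmetric] by simp
    then show "- g + h \<in> N" by (simp add: N_def left_coset_eq_iff)
  next
    assume "- g + h \<in> N"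
    then have "left_coset N g = left_coset N h" by (simp add: N_def left_coset_eq_iff)
    then show "q g = q h" by (simp add: q_def)
  qed
  define s where "s = inv_into UNIV q"
  have q_s: "q (s (q g)) = q g" for g by (simp add: s_def f_inv_into_f)
  have q_shift: "q (g + s (q h)) = q (g + h)" for g h
    using q_s[of h] unfolding q_eq by (simp only: group_normalize)
  define Y where "Y = range q \<times> (UNIV :: nat set)"
  have "infinite Y" unfolding Y_def by (auto simp: finite_cartesian_product_iff)
  then have bij: "bij_betw (to_nat_on Y) Y UNIV"
    by (simp add: to_nat_on_infinite)
  define \<psi> where "\<psi> = inv_into Y (to_nat_on Y)"
  have \<psi>_Y: "\<psi> i \<in> Y" for i
    unfolding \<psi>_def by (meson UNIV_I bij bij_betw_apply bij_betw_inv_into)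
  have \<psi>1: "to_nat_on Y (\<psi> i) = i" for i
    unfolding \<psi>_def using bij by (simp add: bij_betw_inv_into_right)
  have \<psi>2: "\<psi> (to_nat_on Y y) = y" if "y \<in> Y" for y
    unfolding \<psi>_def using bij that by (simp add: bij_betw_inv_into_left)
  define act where "act = (\<lambda>g y. (q (g + s (fst y)), snd y :: nat))"
  have act_Y: "act g y \<in> Y" if "y \<in> Y" for g y using that by (auto simp: act_def Y_def)
  have act_0: "act 0 y = y" if "y \<in> Y" for y using that by (auto simp: act_def Y_def q_s)
  have act_add: "act (g + h) y = act g (act h y)" for g h y
    by (simp add: act_def q_shift add.assoc)
  have act_fix: "act g y = y \<longleftrightarrow> g \<in> N" if yY: "y \<in> Y" for g y
  proof -
    obtain h i where y: "y = (q h, i)" using yY by (auto simp: Y_def)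
    have "act g y = y \<longleftrightarrow> q h = q (g + h)" by (auto simp: act_def y q_shift)
    also have "\<dots> \<longleftrightarrow> - h + (g + h) \<in> N" by (rule q_eq)
    also have "\<dots> \<longleftrightarrow> g \<in> N"
    proof
      assume "- h + (g + h) \<in> N"
      from conj[OF this, of h] show "g \<in> N" by (simp only: group_normalize)
    next
      assume "g \<in> N"
      from conj[OF this, of "- h"] show "- h + (g + h) \<in> N" by (simp only: group_normalize)
    qed
    finally show ?thesis .
  qed
  define A where "A = (\<lambda>g i. to_nat_on Y (act g (\<psi> i)))"
  have A_add: "A (g + h) i = A g (A h i)" for g h i
    by (simp add: A_def act_add \<psi>2 act_Y \<psi>_Y)
  have A_0: "A 0 i = i" for i by (simp add: A_def act_0 \<psi>_Y \<psi>1)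
  have "bij (A g)" for g
    by (rule o_bij[of "A (- g)"]) (auto simp: fun_eq_iff A_add[symmetric] A_0)
  then have ap: "apply_perm (Perm (A g)) = A g" for g by (simp add: Perm_inverse)
  show ?thesis
  proof (rule that[of "\<lambda>g. Perm (A g)" "\<lambda>i. snd (\<psi> i)"])
    show "Perm (A (g + h)) = Perm (A g) + Perm (A h)" for g h
      by (rule permutation_eqI) (simp add: ap A_add)
    show "apply_perm (Perm (A g)) i = i \<longleftrightarrow> g \<in> normal_closure S" for g i
    proof -
      have "A g i = i \<longleftrightarrow> act g (\<psi> i) = \<psi> i" by (metis A_def \<psi>1 \<psi>2 \<psi>_Y act_Y)
      then show ?thesis by (simp add: ap act_fix \<psi>_Y N_def)
    qed
    show "snd (\<psi> (apply_perm (Perm (A g)) i)) = snd (\<psi> i)" for g i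
      unfolding ap by (simp add: A_def \<psi>2[OF act_Y[OF \<psi>_Y]]) (simp add: act_def)
    have "snd (\<psi> (to_nat_on Y (q 0, i))) = i" for i
      using \<psi>2[of "(q 0, i)"] by (simp add: Y_def)
    then show "surj (\<lambda>i. snd (\<psi> i))" by (metis surjI)
  qed
qed

text \<open>A free action is a disjoint union of copies of the translation action, one for each orbit;
  an orbit is represented by its least element.\<close>

lemma free_action_transversal:
  fixes K :: "'g::group_add set" and \<alpha> :: "'g \<Rightarrow> nat permutation" and \<kappa> :: "nat \<Rightarrow> nat"
  assumes K: "0 \<in> K" "\<And>g h. g \<in> K \<Longrightarrow> h \<in> K \<Longrightarrow> g + h \<in> K" "\<And>g. g \<in> K \<Longrightarrow> - g \<in> K"
    and add: "\<And>g h. \<alpha> (g + h) = \<alpha> g + \<alpha> h"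
    and free: "\<And>g i. g \<in> K \<Longrightarrow> apply_perm (\<alpha> g) i = i \<Longrightarrow> g = 0"
    and \<kappa>: "\<And>g i. \<kappa> (apply_perm (\<alpha> g) i) = \<kappa> i" "surj \<kappa>"
  obtains R where "infinite R" "bij_betw (\<lambda>(g, i). apply_perm (\<alpha> g) i) (K \<times> R) UNIV"
proof
  define rep where "rep = (\<lambda>i. LEAST j. \<exists>g\<in>K. j = apply_perm (\<alpha> g) i)"
  have \<alpha>0: "\<alpha> 0 = 0" by (rule group_hom_zero) (rule add)
  have inverse: "apply_perm (\<alpha> (- g)) (apply_perm (\<alpha> g) i) = i" for g i
    using add[of "- g" g] by (simp flip: apply_perm_add add: \<alpha>0)
  have rep: "\<exists>g\<in>K. rep i = apply_perm (\<alpha> g) i" for i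
    unfolding rep_def by (rule LeastI_ex) (use K(1) in blast)
  have rep_act: "rep (apply_perm (\<alpha> g) i) = rep i" if "g \<in> K" for g i
  proof -
    have "(\<exists>h\<in>K. j = apply_perm (\<alpha> h) (apply_perm (\<alpha> g) i)) \<longleftrightarrow> (\<exists>h\<in>K. j = apply_perm (\<alpha> h) i)" for j
    proof
      assume "\<exists>h\<in>K. j = apply_perm (\<alpha> h) (apply_perm (\<alpha> g) i)"
      then obtain h where "h \<in> K" "j = apply_perm (\<alpha> (h + g)) i" by (auto simp: add)
      then show "\<exists>h\<in>K. j = apply_perm (\<alpha> h) i" using K(2) that by blast
    next
      assume "\<exists>h\<in>K. j = apply_perm (\<alpha> h) i"
      then obtain h where h: "h \<in> K" "j = apply_perm (\<alpha> h) i" by blast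
      then have "j = apply_perm (\<alpha> (h + - g)) (apply_perm (\<alpha> g) i)"
        by (simp only: add apply_perm_add inverse)
      then show "\<exists>h\<in>K. j = apply_perm (\<alpha> h) (apply_perm (\<alpha> g) i)"
        using h K(2,3) that by blast
    qed
    then show ?thesis by (simp add: rep_def)
  qed
  have rep_rep: "rep (rep i) = rep i" for i using rep[of i] rep_act by auto
  have "\<kappa> (rep i) = \<kappa> i" for i using rep[of i] \<kappa>(1) by auto
  then have "\<kappa> ` range rep = UNIV" using \<kappa>(2) by (simp add: image_image)
  then show "infinite (range rep)" by (metis finite_imageI infinite_UNIV_nat)
  show "bij_betw (\<lambda>(g, i). apply_perm (\<alpha> g) i) (K \<times> range rep) UNIV"
    unfolding bij_betw_def
  proof
    show "inj_on (\<lambda>(g, i). apply_perm (\<alpha> g) i) (K \<times> range rep)"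
    proof (rule inj_onI, clarify)
      fix g h i j
      assume gh: "g \<in> K" "h \<in> K" and eq: "apply_perm (\<alpha> g) (rep i) = apply_perm (\<alpha> h) (rep j)"
      have ij: "rep i = rep j" by (metis eq gh rep_act rep_rep)
      have "apply_perm (\<alpha> (- h + g)) (rep i) = rep i"
        using eq inverse by (simp add: add ij)
      then have "- h + g = 0" by (intro free) (use K gh in auto)
      then show "g = h \<and> rep i = rep j" using ij by (metis add_minus_cancel add_0_right)
    qed
    have "i \<in> (\<lambda>(g, i). apply_perm (\<alpha> g) i) ` (K \<times> range rep)" for i
    proof -
      obtain g where g: "g \<in> K" "rep i = apply_perm (\<alpha> g) i" using rep by blast
      then have "i = apply_perm (\<alpha> (- g)) (rep i)" by (simp add: inverse)
      then show ?thesis using g(1) K(3) by force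
    qed
    then show "(\<lambda>(g, i). apply_perm (\<alpha> g) i) ` (K \<times> range rep) = UNIV" by blast
  qed
qed

text \<open>This replaces HNN extensions. Two free actions with countably infinitely many orbits differ only
  by a bijection of their transversals, so some permutation conjugates one into the other. Applied to
  two isomorphic subgroups of a permutation group, it supplies a stable letter without enlarging
  the set that is acted on, and the base group acts as before.\<close>

lemma free_actions_conjugate:
  fixes K :: "'g::group_add set" and \<alpha> \<beta> :: "'g \<Rightarrow> nat permutation" and \<kappa> \<mu> :: "nat \<Rightarrow> nat"
  assumes K: "0 \<in> K" "\<And>g h. g \<in> K \<Longrightarrow> h \<in> K \<Longrightarrow> g + h \<in> K" "\<And>g. g \<in> K \<Longrightarrow> - g \<in> K"
    and \<alpha>: "\<And>g h. \<alpha> (g + h) = \<alpha> g + \<alpha> h"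
      "\<And>g i. g \<in> K \<Longrightarrow> apply_perm (\<alpha> g) i = i \<Longrightarrow> g = 0"
      "\<And>g i. \<kappa> (apply_perm (\<alpha> g) i) = \<kappa> i" "surj \<kappa>"
    and \<beta>: "\<And>g h. \<beta> (g + h) = \<beta> g + \<beta> h"
      "\<And>g i. g \<in> K \<Longrightarrow> apply_perm (\<beta> g) i = i \<Longrightarrow> g = 0"
      "\<And>g i. \<mu> (apply_perm (\<beta> g) i) = \<mu> i" "surj \<mu>"
  shows "\<exists>t. \<forall>g\<in>K. t + \<alpha> g = \<beta> g + t"
proof -
  let ?F = "\<lambda>(g, i). apply_perm (\<alpha> g) i" and ?G = "\<lambda>(g, i). apply_perm (\<beta> g) i"
  obtain R where R: "infinite R" "bij_betw ?F (K \<times> R) UNIV"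
    using free_action_transversal[of K \<alpha> \<kappa>] K \<alpha> by blast
  obtain S where S: "infinite S" "bij_betw ?G (K \<times> S) UNIV"
    using free_action_transversal[of K \<beta> \<mu>] K \<beta> by blast
  define \<tau> where "\<tau> = inv_into S (to_nat_on S) \<circ> to_nat_on R"
  have "bij_betw (to_nat_on R) R UNIV" "bij_betw (to_nat_on S) S UNIV"
    using R(1) S(1) by (simp_all add: to_nat_on_infinite)
  then have "bij_betw \<tau> R S"
    unfolding \<tau>_def by (blast intro: bij_betw_trans bij_betw_inv_into)
  then have "bij_betw (map_prod id \<tau>) (K \<times> R) (K \<times> S)"
    by (intro bij_betw_map_prod) auto
  define t where "t = ?G \<circ> map_prod id \<tau> \<circ> inv_into (K \<times> R) ?F"
  have "bij t"
    unfolding t_def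
    by (rule bij_betw_trans[OF bij_betw_inv_into[OF R(2)]], rule bij_betw_trans) fact+
  have t: "t (apply_perm (\<alpha> g) i) = apply_perm (\<beta> g) (\<tau> i)" if "g \<in> K" "i \<in> R" for g i
    using bij_betw_inv_into_left[OF R(2), of "(g, i)"] that by (simp add: t_def)
  show ?thesis
  proof (rule exI[of _ "Perm t"], intro ballI, rule permutation_eqI)
    fix g i assume g: "g \<in> K"
    have "i \<in> ?F ` (K \<times> R)" using R(2) by (simp add: bij_betw_def)
    then obtain h j where h: "h \<in> K" "j \<in> R" "i = apply_perm (\<alpha> h) j" by auto
    have "t (apply_perm (\<alpha> (g + h)) j) = apply_perm (\<beta> (g + h)) (\<tau> j)"
      using K(2) g h by (intro t) auto
    then have "t (apply_perm (\<alpha> g) i) = apply_perm (\<beta> g) (t i)"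
      by (simp add: \<alpha> \<beta> h t)
    then show "apply_perm (Perm t + \<alpha> g) i = apply_perm (\<beta> g + Perm t) i"
      using \<open>bij t\<close> by (simp add: Perm_inverse)
  qed
qed

definition zpow :: "'g::group_add \<Rightarrow> int \<Rightarrow> 'g" where
  "zpow t k = (if 0 \<le> k then ((+) t ^^ nat k) 0 else - ((+) t ^^ nat (- k)) 0)"

lemma zpow_0 [simp]: "zpow t 0 = 0"
  by (simp add: zpow_def)

lemma zpow_succ: "zpow t (k + 1) = zpow t k + t"
proof -
  have comm: "((+) t ^^ n) 0 + t = t + ((+) t ^^ n) 0" for n
    by (induction n) (simp_all add: add.assoc)
  show ?thesis
  proof (cases "0 \<le> k")
    case True
    then show ?thesis by (simp add: zpow_def nat_add_distrib comm)
  next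
    case False
    then have "nat (- k) = Suc (nat (- (k + 1)))" by simp
    then have "((+) t ^^ nat (- k)) 0 = t + ((+) t ^^ nat (- (k + 1))) 0" by simp
    moreover have "zpow t (k + 1) = - ((+) t ^^ nat (- (k + 1))) 0"
      using False by (cases "k = -1") (auto simp: zpow_def)
    ultimately show ?thesis using False
      by (simp add: zpow_def minus_add add.assoc)
  qed
qed

lemma zpow_add: "zpow t (k + l) = zpow t k + zpow t l"
proof (induction l rule: int_induct[where k = 0])
  case (step1 i)
  then show ?case using zpow_succ[of t "k + i"] zpow_succ[of t i] by (simp add: add.assoc)
next
  case (step2 i)
  have "zpow t (k + (i - 1)) + t = zpow t k + zpow t (i - 1) + t"
    using step2 zpow_succ[of t "k + (i - 1)"] zpow_succ[of t "i - 1"] by (simp add: add.assoc)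
  then show ?case by simp
qed simp

lemma zpow_uminus: "zpow t (- k) = - zpow t k"
  using zpow_add[of t "- k" k] by (simp add: eq_neg_iff_add_eq_0)

section \<open>Rewriting along a weight\<close>

text \<open>Magnus rewriting with respect to integer weights \<open>h\<close> of the generators. Substitute
  \<open>b \<mapsto> t\<^bsup>h b\<^esup>\<close> and \<open>g \<mapsto> y\<^sub>g t\<^bsup>h g\<^esup>\<close> for \<open>g \<noteq> b\<close>, and let \<open>(g, k)\<close> stand for the conjugate
  \<open>t\<^bsup>k\<^esup> y\<^sub>g t\<^bsup>-k\<^esup>\<close>. Moving all powers of \<open>t\<close> in \<open>t\<^bsup>k\<^esup> w\<close> to the right leaves a word in these
  conjugates. The height \<open>k\<close> is the weight that has been read so far. An inverse
  letter lowers the height before it is recorded, hence the case distinction.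

  Arbitrary weights cover both cases of the classical argument: a generator of exponent sum \<open>0\<close>, and
  the embedding that creates one by adjoining a root of \<open>b\<close>.\<close>

definition lift_letter :: "('a \<Rightarrow> int) \<Rightarrow> int \<Rightarrow> 'a letter \<Rightarrow> ('a \<times> int) letter" where
  "lift_letter h k p = ((fst p, if snd p then k else k - h (fst p)), snd p)"

fun lift_word :: "('a \<Rightarrow> int) \<Rightarrow> 'a \<Rightarrow> int \<Rightarrow> 'a letter list \<Rightarrow> ('a \<times> int) letter list" where
  "lift_word h b k [] = []"
| "lift_word h b k (p # w) =
     (if fst p = b then [] else [lift_letter h k p]) @ lift_word h b (k + letter_val h p) w"

lemma lift_word_append:
  "lift_word h b k (u @ v) = lift_word h b k u @ lift_word h b (k + word_val h u) v"
  by (induction u arbitrary: k) (auto simp: add.assoc)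

lemma lift_word_eq_Nil_iff: "lift_word h b k w = [] \<longleftrightarrow> fst ` set w \<subseteq> {b}"
  by (induction w arbitrary: k) auto

lemma length_lift_word: "length (lift_word h b k w) = length (filter (\<lambda>p. fst p \<noteq> b) w)"
  by (induction w arbitrary: k) auto

lemma generators_lift_word: "fst ` fst ` set (lift_word h b k w) = fst ` set w - {b}"
  by (induction w arbitrary: k) (auto simp: lift_letter_def)

lemma occurs_in_lift_word:
  assumes "occurs_in (g, j) (lift_word h b k w)"
  shows "g \<noteq> b \<and> occurs_in g w"
proof -
  have "fst (g, j) \<in> fst ` fst ` set (lift_word h b k w)"
    using assms unfolding occurs_in_def by (rule imageI)
  then show ?thesis by (simp add: generators_lift_word occurs_in_def)
qed

lemma ex_occurs_in_lift_word:
  assumes "occurs_in g w" "g \<noteq> b"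
  shows "\<exists>j. occurs_in (g, j) (lift_word h b k w)"
proof -
  have "g \<in> fst ` fst ` set (lift_word h b k w)"
    using assms by (simp add: generators_lift_word occurs_in_def)
  then obtain c where "c \<in> fst ` set (lift_word h b k w)" "g = fst c" by blast
  then show ?thesis unfolding occurs_in_def by (cases c) auto
qed

text \<open>Heights record enough to recover the cancellations: lifted letters are mutually inverse only if
  they lift inverse letters with nothing of nonzero weight in between.\<close>

lemma lift_letter_inv_iff:
  "lift_letter h l q = inv_letter (lift_letter h k p) \<longleftrightarrow>
     q = inv_letter p \<and> l = k + letter_val h p"
  by (cases p; cases q) (auto simp: lift_letter_def inv_letter_def letter_val_def)

lemma reduced_one_generator:
  assumes "reduced w" "fst ` set w \<subseteq> {b}"
  shows "\<exists>n s. w = replicate n (b, s)"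
  using assms
proof (induction w)
  case (Cons p w)
  then obtain n s where w: "w = replicate n (b, s)"
    by (auto simp: reduced_Cons)
  obtain s' where p: "p = (b, s')" using Cons.prems by (cases p) auto
  have "s' = s" if "n \<noteq> 0"
    using Cons.prems that by (auto simp: reduced_Cons inv_letter_def w p)
  then have "p # w = replicate (Suc n) (b, s')" by (cases "n = 0") (auto simp: w p)
  then show ?case by blast
qed simp

lemma word_val_replicate_int:
  "word_val h (replicate n (b, s)) = int n * (if s then h b else - h b :: int)"
  by (induction n) (auto simp: letter_val_def algebra_simps)

lemma reduced_one_generator_weight_0:
  assumes "reduced w" "fst ` set w \<subseteq> {b}" "word_val h w = (0 :: int)" "h b \<noteq> 0"
  shows "w = []"
proof -
  obtain n s where w: "w = replicate n (b, s)"
    using reduced_one_generator[OF assms(1,2)] by blast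
  have "n = 0" using assms(3,4) by (simp add: w word_val_replicate_int split: if_splits)
  then show ?thesis by (simp add: w)
qed

text \<open>Two lifted letters that become neighbours are separated in the original word by a power of \<open>b\<close>.
  If they cancelled, that power would have weight \<open>0\<close>, so it would be empty and the original
  letters would already cancel.\<close>

lemma reduced_lift_word:
  assumes "reduced w" "h b \<noteq> 0"
  shows "reduced (lift_word h b k w)"
  using assms(1)
proof (induction w arbitrary: k)
  case (Cons p w)
  then have red: "reduced w" and ne: "w \<noteq> [] \<Longrightarrow> hd w \<noteq> inv_letter p"
    by (auto simp: reduced_Cons)
  let ?l = "k + letter_val h p"
  have IH: "reduced (lift_word h b ?l w)" using Cons.IH red by blast
  show ?case
  proof (cases "fst p = b")
    case False
    have "hd (lift_word h b ?l w) \<noteq> inv_letter (lift_letter h k p)" if "lift_word h b ?l w \<noteq> []"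
    proof
      assume eq: "hd (lift_word h b ?l w) = inv_letter (lift_letter h k p)"
      have "\<exists>q\<in>set w. fst q \<noteq> b" using that by (auto simp: lift_word_eq_Nil_iff)
      then obtain u q v where w: "w = u @ q # v" "fst q \<noteq> b" and u: "\<forall>q\<in>set u. \<not> fst q \<noteq> b"
        using split_list_first_prop[of w "\<lambda>q. fst q \<noteq> b"] by blast
      then have u_b: "fst ` set u \<subseteq> {b}" by auto
      then have "lift_word h b ?l u = []" by (simp add: lift_word_eq_Nil_iff)
      then have "hd (lift_word h b ?l w) = lift_letter h (?l + word_val h u) q"
        using w by (simp add: lift_word_append)
      with eq have q: "q = inv_letter p" and "word_val h u = 0"
        by (simp_all add: lift_letter_inv_iff)
      moreover have "reduced u" using red w(1) by (simp add: reduced_append)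
      ultimately have "u = []"
        using reduced_one_generator_weight_0[of u b h] u_b assms(2) by blast
      then show False using ne w(1) q by simp
    qed
    then show ?thesis using IH False by (simp add: reduced_Cons)
  qed (use IH in simp)
qed simp

lemma cyclically_reduced_lift_word:
  assumes "cyclically_reduced r" "h b \<noteq> 0" "word_val h r = 0"
  shows "cyclically_reduced (lift_word h b 0 r)"
  using assms reduced_lift_word[of "r @ r" h b 0]
  by (simp add: cyclically_reduced_iff lift_word_append)

section \<open>The base group embeds\<close>

text \<open>Magnus' Freiheitssatz: omitting one generator of the relator leaves a free basis of the subgroup
  that the remaining generators span in the one-relator group.\<close>

definition freiheitssatz :: "'a letter list \<Rightarrow> bool" where
  "freiheitssatz r \<longleftrightarrow> (\<forall>z w. occurs_in z r \<longrightarrow> reduced w \<longrightarrow> w \<noteq> [] \<longrightarrow> \<not> occurs_in z w \<longrightarrow>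
     word_elem w \<notin> normal_closure {word_elem r})"

lemma freiheitssatz_subgroup:
  assumes "freiheitssatz r" "occurs_in z r" "\<not> occurs_in z w"
    and "word_elem w \<in> normal_closure {word_elem r}"
  shows "word_elem w = 0"
proof -
  obtain w' where w': "reduced w'" "set w' \<subseteq> set w" "word_elem w' = word_elem w"
    using reduced_representative by blast
  then have "\<not> occurs_in z w'" using assms(3) by (auto simp: occurs_in_def)
  then have "w' = []"
    using assms(1)[unfolded freiheitssatz_def, rule_format, OF assms(2) w'(1)] assms(4) w'(3)
    by auto
  then show ?thesis using w'(3) by simp
qed

text \<open>The key step. Let \<open>H\<close> be the one-relator group of the lifted relator \<open>s\<close>. In \<open>H\<close> the Freiheitssatz
  for \<open>s\<close> says that all generators except \<open>(a, M)\<close>, and all except \<open>(a, m)\<close>, span free subgroups; among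
  the generators with heights of \<open>a\<close> between \<open>m\<close> and \<open>M\<close>, raising heights by \<open>1\<close> maps the first
  basis to the second. Both
  act freely in the regular action of \<open>H\<close>, so a permutation \<open>t\<close> realizes this
  isomorphism by conjugation. Sending \<open>b\<close> to \<open>t\<^bsup>h b\<^esup>\<close> and every other \<open>g\<close> to \<open>y\<^sub>g t\<^bsup>h g\<^esup>\<close> represents the group
  of \<open>r\<close> in such a way that a word with heights in the allowed range acts through its lift.
  A word that is trivial modulo \<open>r\<close> thus lifts to an element with trivial action, which is trivial
  modulo \<open>s\<close> because the action of \<open>H\<close> is faithful.\<close>

lemma lift_word_normal_closure:
  fixes r w :: "'a::countable letter list" and h :: "'a \<Rightarrow> int" and b :: 'a
  defines "s \<equiv> lift_word h b 0 r"
  assumes wt: "word_val h r = 0" and F: "freiheitssatz s"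
    and m: "occurs_in (a, m) s" and M: "occurs_in (a, M) s"
    and range: "\<And>j. occurs_in (a, j) s \<Longrightarrow> m \<le> j \<and> j \<le> M"
    and w: "word_elem w \<in> normal_closure {word_elem r}"
    and w_range: "\<And>j. occurs_in (a, j) (lift_word h b k w) \<Longrightarrow> m \<le> j \<and> j \<le> M"
  shows "word_elem (lift_word h b k w) \<in> normal_closure {word_elem s}"
proof -
  define N where "N = normal_closure {word_elem s}"
  obtain \<alpha> :: "('a \<times> int) free_group \<Rightarrow> nat permutation" and \<kappa> :: "nat \<Rightarrow> nat"
    where \<alpha>_add: "\<And>g h. \<alpha> (g + h) = \<alpha> g + \<alpha> h"
      and \<alpha>_fix: "\<And>g i. apply_perm (\<alpha> g) i = i \<longleftrightarrow> g \<in> N"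
      and \<kappa>: "\<And>g i. \<kappa> (apply_perm (\<alpha> g) i) = \<kappa> i" "surj \<kappa>"
  proof (rule regular_action[of "{word_elem s}", folded N_def])
    fix \<alpha> :: "('a \<times> int) free_group \<Rightarrow> nat permutation" and \<kappa> :: "nat \<Rightarrow> nat"
    assume "\<And>g h. \<alpha> (g + h) = \<alpha> g + \<alpha> h" "\<And>g i. apply_perm (\<alpha> g) i = i \<longleftrightarrow> g \<in> N"
      "\<And>g i. \<kappa> (apply_perm (\<alpha> g) i) = \<kappa> i" "surj \<kappa>"
    then show thesis by (rule that[of \<alpha> \<kappa>])
  qed
  have \<alpha>_0: "\<alpha> 0 = 0"
    by (rule group_hom_zero) (rule \<alpha>_add)
  have \<alpha>_uminus: "\<alpha> (- g) = - \<alpha> g" for g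
    by (rule group_hom_uminus) (rule \<alpha>_add)
  have \<alpha>_eq_0: "\<alpha> g = 0 \<longleftrightarrow> g \<in> N" for g
  proof
    show "g \<in> N" if "\<alpha> g = 0" using \<alpha>_fix[of g 0] that by simp
    show "\<alpha> g = 0" if "g \<in> N" by (rule permutation_eqI) (simp add: \<alpha>_fix that)
  qed
  \<comment> \<open>the generators whose shift is again in the allowed range\<close>
  define A where "A = {(g, j). g = a \<longrightarrow> m \<le> j \<and> j < M}"
  define sh where "sh = (\<lambda>(g :: 'a, j :: int). (g, j + 1))"
  define \<phi> where "\<phi> = free_hom (\<lambda>c. gen (sh c))"
  define K where "K = {word_elem w | w. fst ` set w \<subseteq> A}"
  have \<phi>_word: "\<phi> (word_elem w) = word_elem (map_word sh w)" for w
    by (simp add: \<phi>_def free_hom_word_elem word_val_gen)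
  have inj_sh: "inj sh" by (auto simp: inj_def sh_def)
  have K_reduced: "\<exists>w. reduced w \<and> fst ` set w \<subseteq> A \<and> g = word_elem w" if "g \<in> K" for g
  proof -
    from that obtain w where "fst ` set w \<subseteq> A" "g = word_elem w" by (auto simp: K_def)
    moreover obtain w' where "reduced w'" "set w' \<subseteq> set w" "word_elem w' = word_elem w"
      using reduced_representative by blast
    ultimately show ?thesis by (intro exI[of _ w']) auto
  qed
  have "(a, M) \<notin> A" "(a, m) \<notin> sh ` A" by (auto simp: A_def sh_def)
  have free1: "g = 0" if g: "g \<in> K" "apply_perm (\<alpha> g) i = i" for g i
  proof -
    obtain w where w: "fst ` set w \<subseteq> A" "g = word_elem w" using K_reduced[OF g(1)] by blast
    then have "\<not> occurs_in (a, M) w" using \<open>(a, M) \<notin> A\<close> by (auto simp: occurs_in_def)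
    then show ?thesis
      using freiheitssatz_subgroup[OF F M] g(2) w(2) by (simp add: \<alpha>_fix N_def)
  qed
  have free2: "g = 0" if g: "g \<in> K" "apply_perm (\<alpha> (\<phi> g)) i = i" for g i
  proof -
    obtain w where w: "reduced w" "fst ` set w \<subseteq> A" "g = word_elem w"
      using K_reduced[OF g(1)] by blast
    then have "\<not> occurs_in (a, m) (map_word sh w)"
      using \<open>(a, m) \<notin> sh ` A\<close> by (auto simp: occurs_in_def fst_set_map_word)
    then have "word_elem (map_word sh w) = 0"
      using freiheitssatz_subgroup[OF F m] g(2) w(3) by (simp add: \<alpha>_fix N_def \<phi>_word)
    then have "w = []"
      using w(1) by (simp add: word_elem_reduced_eq_0_iff reduced_map_word inj_sh)
    then show ?thesis by (simp add: w(3))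
  qed
  have K_0: "0 \<in> K" unfolding K_def by (intro CollectI exI[of _ "[]"]) simp
  have K_add: "g + h \<in> K" if gh: "g \<in> K" "h \<in> K" for g h
  proof -
    obtain u v where "g = word_elem u" "h = word_elem v" "fst ` set u \<subseteq> A" "fst ` set v \<subseteq> A"
      using gh by (auto simp: K_def)
    then have "g + h = word_elem (u @ v)" "fst ` set (u @ v) \<subseteq> A"
      by (auto simp: word_elem_append)
    then show ?thesis unfolding K_def by blast
  qed
  have K_uminus: "- g \<in> K" if g: "g \<in> K" for g
  proof -
    obtain u where "g = word_elem u" "fst ` set u \<subseteq> A" using g by (auto simp: K_def)
    then have "- g = word_elem (rev (map inv_letter u))" "fst ` set (rev (map inv_letter u)) \<subseteq> A"
      by (auto simp: uminus_free_group.abs_eq)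
    then show ?thesis unfolding K_def by blast
  qed
  have "\<exists>t. \<forall>g\<in>K. t + \<alpha> g = \<alpha> (\<phi> g) + t"
  proof (rule free_actions_conjugate[where \<kappa> = \<kappa> and \<mu> = \<kappa>])
    show "\<alpha> (\<phi> (g + h)) = \<alpha> (\<phi> g) + \<alpha> (\<phi> h)" for g h
      by (simp add: \<phi>_def free_hom_add \<alpha>_add)
    show "g = 0" if "g \<in> K" "apply_perm (\<alpha> g) i = i" for g i
      using that by (rule free1)
    show "g = 0" if "g \<in> K" "apply_perm (\<alpha> (\<phi> g)) i = i" for g i
      using that by (rule free2)
    show "\<kappa> (apply_perm (\<alpha> g) i) = \<kappa> i" "\<kappa> (apply_perm (\<alpha> (\<phi> g)) i) = \<kappa> i" for g i
      by (rule \<kappa>(1))+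
    show "\<alpha> (g + h) = \<alpha> g + \<alpha> h" for g h
      by (rule \<alpha>_add)
    show "g + h \<in> K" if "g \<in> K" "h \<in> K" for g h
      using that by (rule K_add)
    show "- g \<in> K" if "g \<in> K" for g
      using that by (rule K_uminus)
    show "0 \<in> K" "surj \<kappa>" "surj \<kappa>" by (rule K_0 \<kappa>(2))+
  qed
  then obtain t where t: "\<And>g. g \<in> K \<Longrightarrow> t + \<alpha> g = \<alpha> (\<phi> g) + t" by blast
  define T where "T = zpow t"
  have T_0: "T 0 = 0" and T_1: "T 1 = t" and T_add: "T (i + j) = T i + T j"
    and T_uminus: "T (- i) = - T i" for i j
    using zpow_succ[of t 0] by (simp_all add: T_def zpow_add zpow_uminus)
  define ok where "ok = (\<lambda>g j. g = a \<longrightarrow> m \<le> j \<and> j \<le> M)"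
  have shift: "\<alpha> (gen (g, j + 1)) = T 1 + \<alpha> (gen (g, j)) - T 1" if "ok g j" "ok g (j + 1)" for g j
  proof -
    have "(g, j) \<in> A" using that by (auto simp: A_def ok_def)
    then have "gen (g, j) \<in> K"
      unfolding K_def gen_def by (intro CollectI exI[of _ "[((g, j), True)]"]) simp
    moreover have "\<phi> (gen (g, j)) = gen (g, j + 1)" by (simp add: \<phi>_def sh_def)
    ultimately show ?thesis using t[of "gen (g, j)"] by (simp add: T_1 eq_diff_eq)
  qed
  \<comment> \<open>height \<open>0\<close> need not be allowed for \<open>a\<close>, so its \<open>y\<close> is pulled back from height \<open>m\<close>\<close>
  define og where "og = (\<lambda>g. if g = a then m else 0)"
  define y where "y = (\<lambda>g. - T (og g) + \<alpha> (gen (g, og g)) + T (og g))"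
  have y: "\<alpha> (gen (g, j)) = T j + y g - T j" if "ok g j" for g j
  proof -
    have "ok g j \<longrightarrow> \<alpha> (gen (g, j)) = T j + y g - T j" if "og g \<le> j"
      using that
    proof (induction j rule: int_ge_induct)
      case base
      show ?case unfolding y_def by (simp only: group_normalize simp_thms)
    next
      case (step i)
      show ?case
      proof
        assume ok1: "ok g (i + 1)"
        then have ok: "ok g i" using step.hyps by (auto simp: ok_def og_def)
        have T_i: "T (i + 1) = T 1 + T i" using T_add[of 1 i] by (simp add: add.commute)
        have IH: "\<alpha> (gen (g, i)) = T i + y g - T i" using step.IH ok by simp
        show "\<alpha> (gen (g, i + 1)) = T (i + 1) + y g - T (i + 1)"
          unfolding shift[OF ok ok1] IH T_i by (simp only: group_normalize)
      qed
    qed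
    moreover have "\<alpha> (gen (g, j)) = T j + y g - T j" if "j \<le> og g" "g \<noteq> a"
      using that(1)
    proof (induction j rule: int_le_induct)
      case base
      show ?case unfolding y_def by (simp only: group_normalize)
    next
      case (step i)
      have i: "T i = T 1 + T (i - 1)" using T_add[of 1 "i - 1"] by simp
      have "T 1 + \<alpha> (gen (g, i - 1)) - T 1 = T i + y g - T i"
        using step.IH shift[of g "i - 1"] that(2) by (simp add: ok_def)
      then have "- T 1 + (T 1 + \<alpha> (gen (g, i - 1)) - T 1) + T 1 = - T 1 + (T i + y g - T i) + T 1"
        by simp
      then show ?case unfolding i by (simp only: group_normalize)
    qed
    moreover have "og g \<le> j \<or> j \<le> og g \<and> g \<noteq> a" using that by (auto simp: ok_def og_def)
    ultimately show ?thesis using that by blast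
  qed
  define f where "f = (\<lambda>g. if g = b then T (h b) else y g + T (h g))"
  have main: "T k + word_val f w = \<alpha> (word_elem (lift_word h b k w)) + T (k + word_val h w)"
    if "\<And>g j. occurs_in (g, j) (lift_word h b k w) \<Longrightarrow> ok g j" for k w
    using that
  proof (induction w arbitrary: k)
    case Nil
    then show ?case by (simp add: \<alpha>_0)
  next
    case (Cons p w)
    let ?l = "k + letter_val h p"
    have IH: "T ?l + word_val f w = \<alpha> (word_elem (lift_word h b ?l w)) + T (?l + word_val h w)"
      using Cons.prems by (intro Cons.IH) (auto simp: occurs_in_def)
    have step: "T k + letter_val f p =
      \<alpha> (word_elem (if fst p = b then [] else [lift_letter h k p])) + T ?l"
    proof (cases "fst p = b")
      case True
      then show ?thesis
        by (auto simp: letter_val_def f_def \<alpha>_0 T_add T_uminus diff_conv_add_uminus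
            simp del: add_uminus_conv_diff)
    next
      case False
      have ok: "ok (fst p) (snd (fst (lift_letter h k p)))"
        using False Cons.prems by (auto simp: occurs_in_def lift_letter_def)
      show ?thesis
      proof (cases "snd p")
        case True
        then have "\<alpha> (word_elem [lift_letter h k p]) = T k + y (fst p) - T k"
          using y[of "fst p" k] ok by (simp add: word_elem_letter letter_val_def lift_letter_def)
        then show ?thesis using False True
          by (simp only: letter_val_def f_def T_add group_normalize if_True if_False)
      next
        case s: False
        then have "\<alpha> (word_elem [lift_letter h k p]) =
            - (T (k + - h (fst p)) + y (fst p) - T (k + - h (fst p)))"
          using y[of "fst p" "k + - h (fst p)"] ok
          by (simp add: word_elem_letter letter_val_def lift_letter_def \<alpha>_uminus)
        then show ?thesis using False s
          by (simp only: letter_val_def f_def T_add T_uminus group_normalize if_False)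
      qed
    qed
    have "T k + word_val f (p # w) = (T k + letter_val f p) + word_val f w"
      by (simp add: add.assoc)
    also have "\<dots> = \<alpha> (word_elem (if fst p = b then [] else [lift_letter h k p])) + (T ?l + word_val f w)"
      unfolding step by (simp add: add.assoc)
    also have "\<dots> = \<alpha> (word_elem (lift_word h b k (p # w))) + T (k + word_val h (p # w))"
      unfolding IH by (simp add: word_elem_append \<alpha>_add add.assoc)
    finally show ?case .
  qed
  have "word_elem s \<in> N" by (simp add: N_def normal_closure.base)
  then have "word_val f r = 0"
    using main[of 0 r] range by (auto simp: T_0 wt \<alpha>_eq_0[symmetric] ok_def s_def)
  then have "word_val f w = 0" "word_val h w = 0"
    using free_hom_normal_closure[OF w, of f] free_hom_normal_closure[OF w, of h] wt by (simp_all add: free_hom_word_elem)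
  moreover have "T k + word_val f w = \<alpha> (word_elem (lift_word h b k w)) + T (k + word_val h w)"
    by (rule main) (use w_range in \<open>auto simp: ok_def\<close>)
  ultimately have "0 + T k = \<alpha> (word_elem (lift_word h b k w)) + T k" by simp
  then have "\<alpha> (word_elem (lift_word h b k w)) = 0" by (simp only: add_right_cancel)
  then show ?thesis by (simp add: \<alpha>_eq_0 N_def)
qed

section \<open>Subwords of the relator\<close>

text \<open>Weinbaum's subword property: no nonempty proper subword of the relator is trivial in the
  one-relator group.\<close>

definition weinbaum :: "'a letter list \<Rightarrow> bool" where
  "weinbaum r \<longleftrightarrow> (\<forall>p u q. r = p @ u @ q \<longrightarrow> u \<noteq> [] \<longrightarrow> p @ q \<noteq> [] \<longrightarrow>
     word_elem u \<notin> normal_closure {word_elem r})"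

lemma map_word_normal_closure:
  assumes "word_elem w \<in> normal_closure {word_elem r}"
  shows "word_elem (map_word f w) \<in> normal_closure {word_elem (map_word f r)}"
proof -
  let ?\<phi> = "free_hom (\<lambda>a. gen (f a))"
  have \<phi>: "?\<phi> (word_elem v) = word_elem (map_word f v)" for v
    by (simp add: free_hom_word_elem word_val_gen)
  have "?\<phi> (word_elem w) \<in> normal_closure {word_elem (map_word f r)}"
    by (rule normal_closure_hom[OF free_hom_add _ assms]) (auto simp: \<phi> intro: normal_closure.base)
  then show ?thesis by (simp add: \<phi>)
qed

lemma freiheitssatz_map_word:
  assumes "inj f" "freiheitssatz (map_word f r)"
  shows "freiheitssatz r"
  unfolding freiheitssatz_def
proof (intro allI impI)
  fix z w assume *: "occurs_in z r" "reduced w" "w \<noteq> []" "\<not> occurs_in z w"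
  have "word_elem (map_word f w) \<notin> normal_closure {word_elem (map_word f r)}"
    by (rule assms(2)[unfolded freiheitssatz_def, rule_format, of "f z"])
       (use * assms(1) in \<open>simp_all add: occurs_in_map_word reduced_map_word\<close>)
  then show "word_elem w \<notin> normal_closure {word_elem r}"
    using map_word_normal_closure[of w r f] by blast
qed

lemma weinbaum_map_word:
  assumes "weinbaum (map_word f r)"
  shows "weinbaum r"
  unfolding weinbaum_def
proof (intro allI impI)
  fix p u q assume *: "r = p @ u @ q" "u \<noteq> []" "p @ q \<noteq> []"
  have "word_elem (map_word f u) \<notin> normal_closure {word_elem (map_word f r)}"
    by (rule assms[unfolded weinbaum_def, rule_format, of "map_word f p" _ "map_word f q"])
       (use * in simp_all)
  then show "word_elem u \<notin> normal_closure {word_elem r}"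
    using map_word_normal_closure[of u r f] by blast
qed

text \<open>Mapping \<open>z\<close> to the identity kills the relator, but no word in the other generators.\<close>

lemma freiheitssatz_one_generator:
  assumes "fst ` set r \<subseteq> {z}"
  shows "freiheitssatz r"
  unfolding freiheitssatz_def
proof (intro allI impI notI)
  fix z' w
  assume "occurs_in z' r" "reduced w" "w \<noteq> []" "\<not> occurs_in z' w"
    and w: "word_elem w \<in> normal_closure {word_elem r}"
  then have z: "z \<notin> fst ` set w" using assms by (auto simp: occurs_in_def)
  define f where "f = (\<lambda>g. if g = z then 0 else gen g)"
  have "word_val f r = 0"
    using assms by (induction r) (auto simp: letter_val_def f_def)
  then have "word_val f w = 0"
    using free_hom_normal_closure[OF w, of f] by (simp add: free_hom_word_elem)
  moreover have "word_val f w = word_val gen w"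
    using z by (induction w) (auto simp: letter_val_def f_def)
  ultimately have "word_elem w = 0" by (simp add: word_elem_conv_word_val)
  then show False using \<open>reduced w\<close> \<open>w \<noteq> []\<close> by (simp add: word_elem_reduced_eq_0_iff)
qed

text \<open>The relator is a power \<open>z\<^bsup>n\<^esup>\<close> up to sign, and the exponent sum of an element of its normal closure is divisible
  by \<open>n\<close>.\<close>

lemma weinbaum_one_generator:
  assumes "reduced r" "fst ` set r \<subseteq> {z}"
  shows "weinbaum r"
  unfolding weinbaum_def
proof (intro allI impI notI)
  fix p u q
  assume r: "r = p @ u @ q" "u \<noteq> []" "p @ q \<noteq> []"
    and u: "word_elem u \<in> normal_closure {word_elem r}"
  obtain n s where n: "r = replicate n (z, s)"
    using reduced_one_generator[OF assms] by blast
  have "set u \<subseteq> set r" using r(1) by auto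
  then have "set u \<subseteq> {(z, s)}" using n by auto
  then have u': "u = replicate (length u) (z, s)"
    by (metis replicate_eqI singletonD subsetD)
  let ?e = "free_hom (\<lambda>_. 1 :: int)"
  define c :: int where "c = (if s then 1 else - 1)"
  have e_r: "?e (word_elem r) = int n * c"
    unfolding n free_hom_word_elem word_val_replicate_int by (simp add: c_def)
  have "int n dvd ?e g" if "g \<in> normal_closure {word_elem r}" for g
    using that
  proof (induction rule: normal_closure.induct)
    case (conjugate h g)
    have "?e (g + h - g) = ?e h" by (simp only: diff_conv_add_uminus free_hom_add free_hom_uminus)
    then show ?case using conjugate by simp
  qed (auto simp: e_r free_hom_add free_hom_uminus)
  moreover have "?e (word_elem u) = int (length u) * c"
    by (subst u') (simp only: free_hom_word_elem word_val_replicate_int c_def)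
  ultimately have "int n dvd int (length u) * c" using u by metis
  then have "n dvd length u" by (simp add: c_def split: if_splits)
  moreover have "n = length p + length u + length q"
    using arg_cong[OF r(1), of length] n by simp
  ultimately show False using r(2,3) by (auto dest!: dvd_imp_le)
qed

lemma word_val_linear:
  "word_val (\<lambda>g. x * f g + y * f' g :: int) w = x * word_val f w + y * word_val f' w"
  by (induction w) (auto simp: letter_val_def algebra_simps)

lemma word_val_eq_0: "(\<And>g. occurs_in g w \<Longrightarrow> f g = 0) \<Longrightarrow> word_val f w = 0"
  by (induction w) (auto simp: letter_val_def occurs_in_def)

lemma lift_word_height:
  assumes "\<And>g. occurs_in g w \<Longrightarrow> h g = 0" "occurs_in (g, j) (lift_word h b k w)"
  shows "j = k"
  using assms
proof (induction w)
  case (Cons p w)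
  have hp: "h (fst p) = 0" using Cons.prems(1) by (simp add: occurs_in_def)
  have "j = k" if "occurs_in (g, j) (lift_word h b k w)"
    using that by (rule Cons.IH[rotated]) (use Cons.prems(1) in \<open>simp add: occurs_in_def\<close>)
  then show ?case
    using Cons.prems(2) hp
    by (auto simp: occurs_in_def letter_val_def lift_letter_def split: if_splits)
qed (simp add: occurs_in_def)

text \<open>Each power of \<open>b\<close> between two lifted letters of equal height has weight \<open>0\<close>, hence is empty: \<open>b\<close>
  occurs only at the two ends.\<close>

lemma constant_height_decomposition:
  assumes "reduced w" "h b \<noteq> 0" "\<And>g. g \<noteq> b \<Longrightarrow> h g = 0"
    and "\<And>g j. occurs_in (g, j) (lift_word h b k w) \<Longrightarrow> j = m"
  shows "\<exists>u v u'. w = u @ v @ u' \<and> fst ` set u \<subseteq> {b} \<and> fst ` set u' \<subseteq> {b} \<and> b \<notin> fst ` set v \<and>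
    (v \<noteq> [] \<longrightarrow> k + word_val h u = m)"
  using assms(1,4)
proof (induction w arbitrary: k)
  case Nil
  then show ?case by (intro exI[of _ "[]"]) simp
next
  case (Cons p w)
  have "reduced w" using Cons.prems(1) by (simp add: reduced_Cons)
  moreover have "j = m" if "occurs_in (g, j) (lift_word h b (k + letter_val h p) w)" for g j
    by (rule Cons.prems(2)[of g]) (use that in \<open>simp add: occurs_in_def\<close>)
  ultimately obtain u v u' where w: "w = u @ v @ u'" "fst ` set u \<subseteq> {b}" "fst ` set u' \<subseteq> {b}"
    "b \<notin> fst ` set v" "v \<noteq> [] \<longrightarrow> k + letter_val h p + word_val h u = m"
    using Cons.IH[of "k + letter_val h p"] by blast
  show ?case
  proof (cases "fst p = b")
    case True
    then show ?thesis using w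
      by (intro exI[of _ "p # u"] exI[of _ v] exI[of _ u']) (auto simp: add.assoc)
  next
    case False
    then have hp: "h (fst p) = 0" by (rule assms(3))
    have "k = m" by (rule Cons.prems(2)[of "fst p"]) (use False hp in \<open>simp add: occurs_in_def lift_letter_def\<close>)
    show ?thesis
    proof (cases "v = []")
      case True
      then show ?thesis using w False \<open>k = m\<close>
        by (intro exI[of _ "[]"] exI[of _ "[p]"] exI[of _ "u @ u'"]) auto
    next
      case False
      with w(5) \<open>k = m\<close> hp have "word_val h u = 0" by (simp add: letter_val_def split: if_splits)
      moreover have "reduced u" using \<open>reduced w\<close> w(1) by (simp add: reduced_append)
      ultimately have "u = []"
        using reduced_one_generator_weight_0[of u b h] w(2) assms(2) by blast
      then show ?thesis using w \<open>fst p \<noteq> b\<close> \<open>k = m\<close>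
        by (intro exI[of _ "[]"] exI[of _ "p # v"] exI[of _ u']) auto
    qed
  qed
qed

text \<open>In the cyclic word the two ends meet, and form a reduced power of \<open>b\<close> of weight \<open>0\<close>.\<close>

lemma cyclically_reduced_ends:
  assumes "cyclically_reduced (p @ u @ q)" "fst ` set p \<subseteq> {b}" "fst ` set q \<subseteq> {b}"
    and "word_val h p + word_val h q = (0 :: int)" "h b \<noteq> 0"
  shows "p = []" "q = []"
proof -
  have "reduced (q @ p)"
    using assms(1) reduced_append[of "p @ u" "(q @ p) @ u @ q"] reduced_append[of "q @ p" "u @ q"]
    by (simp add: cyclically_reduced_iff)
  moreover have "fst ` set (q @ p) \<subseteq> {b}" "word_val h (q @ p) = 0" using assms by auto
  ultimately have "q @ p = []" using reduced_one_generator_weight_0[of "q @ p" b h] assms(5) by blast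
  then show "p = []" "q = []" by auto
qed

lemma ex_two_heights:
  assumes "cyclically_reduced r" "h b \<noteq> 0" "\<And>g. g \<noteq> b \<Longrightarrow> h g = 0" "word_val h r = 0"
    and "occurs_in b r" "occurs_in c r" "c \<noteq> b"
  shows "\<exists>g j. occurs_in (g, j) (lift_word h b 0 r) \<and> j \<noteq> m"
proof (rule ccontr)
  assume "\<nexists>g j. occurs_in (g, j) (lift_word h b 0 r) \<and> j \<noteq> m"
  then have "\<exists>u v u'. r = u @ v @ u' \<and> fst ` set u \<subseteq> {b} \<and> fst ` set u' \<subseteq> {b} \<and>
      b \<notin> fst ` set v \<and> (v \<noteq> [] \<longrightarrow> 0 + word_val h u = m)"
    by (intro constant_height_decomposition)
       (use assms in \<open>auto simp: cyclically_reduced_def\<close>)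
  then obtain u v u' where r: "r = u @ v @ u'" and u: "fst ` set u \<subseteq> {b}" "fst ` set u' \<subseteq> {b}"
    and v: "b \<notin> fst ` set v" by blast
  have "word_val h v = 0"
  proof (rule word_val_eq_0)
    fix g assume "occurs_in g v"
    then have "g \<noteq> b" using v by (auto simp: occurs_in_def)
    then show "h g = 0" by (rule assms(3))
  qed
  then have "word_val h u + word_val h u' = 0" using assms(4) r by simp
  then have "u = []" "u' = []"
    using cyclically_reduced_ends[of u v u' b h] assms(1,2) u r by auto
  then show False using v r assms(5) by (simp add: occurs_in_def)
qed

lemma height_bounds:
  assumes "occurs_in a r" "a \<noteq> b"
  obtains m M where "occurs_in (a, m) (lift_word h b k r)" "occurs_in (a, M) (lift_word h b k r)"
    "\<forall>j. occurs_in (a, j) (lift_word h b k r) \<longrightarrow> m \<le> j \<and> j \<le> M"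
proof -
  define J where "J = {j. occurs_in (a, j) (lift_word h b k r)}"
  have "J \<subseteq> snd ` fst ` set (lift_word h b k r)" by (force simp: J_def occurs_in_def)
  then have fin: "finite J" by (rule finite_subset) simp
  have "J \<noteq> {}" using ex_occurs_in_lift_word[OF assms] by (auto simp: J_def)
  then have "Min J \<in> J" "Max J \<in> J" using fin by simp_all
  then show ?thesis using that[of "Min J" "Max J"] fin by (auto simp: J_def)
qed

text \<open>A word \<open>w\<close> without \<open>z\<close> that is trivial modulo \<open>r\<close> is lifted in such a way that its lift avoids a
  generator of the lifted relator. If the exponent sum of \<open>z\<close> in \<open>r\<close> is not \<open>0\<close>, then \<open>z\<close> is
  kept and another generator \<open>c\<close> plays the part of \<open>b\<close>: no lift of \<open>z\<close> appears. If it is \<open>0\<close>, then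
  \<open>z\<close> itself plays the part of \<open>b\<close> and the other generators get weight \<open>0\<close>: all letters of the lift
  have the same height, whereas the relator uses two heights.\<close>

lemma freiheitssatz_step:
  fixes r :: "'a::countable letter list"
  assumes r: "cyclically_reduced r"
    and IH: "\<And>(h :: 'a \<Rightarrow> int) b. occurs_in b r \<Longrightarrow> h b \<noteq> 0 \<Longrightarrow> word_val h r = 0 \<Longrightarrow>
      freiheitssatz (lift_word h b 0 r)"
    and z: "occurs_in z r" "occurs_in c r" "c \<noteq> z"
    and w: "reduced w" "w \<noteq> []" "\<not> occurs_in z w"
  shows "word_elem w \<notin> normal_closure {word_elem r}"
proof
  assume wr: "word_elem w \<in> normal_closure {word_elem r}"
  define e where "e = (\<lambda>x. word_val (\<lambda>g. if g = x then 1 else 0 :: int) r)"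
  show False
  proof (cases "e z = 0")
    case False
    \<comment> \<open>the exponent sums of \<open>c\<close> and \<open>z\<close>, crosswise, so that \<open>r\<close> has weight \<open>0\<close>\<close>
    define h where "h = (\<lambda>g. e z * (if g = c then 1 else 0) + (- e c) * (if g = z then 1 else 0 :: int))"
    have hr: "word_val h r = 0" unfolding h_def word_val_linear by (simp add: e_def)
    have hc: "h c \<noteq> 0" using False z(3) by (simp add: h_def)
    let ?s = "lift_word h c 0 r"
    have F: "freiheitssatz ?s" by (rule IH[OF z(2) hc hr])
    obtain m M where mM: "occurs_in (z, m) ?s" "occurs_in (z, M) ?s"
      "\<forall>j. occurs_in (z, j) ?s \<longrightarrow> m \<le> j \<and> j \<le> M"
      by (rule height_bounds[OF z(1) not_sym[OF z(3)], of h 0])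
    have no_z: "\<not> occurs_in (z, j) (lift_word h c 0 w)" for j
      using occurs_in_lift_word[of z j h c 0 w] w(3) by blast
    have "word_elem (lift_word h c 0 w) \<in> normal_closure {word_elem ?s}"
      by (rule lift_word_normal_closure[OF hr F mM(1,2) mM(3)[rule_format] wr]) (use no_z in blast)+
    moreover have "word_val h w = 0"
      using free_hom_normal_closure[OF wr hr] by (simp add: free_hom_word_elem)
    then have "lift_word h c 0 w \<noteq> []"
      using reduced_one_generator_weight_0[of w c h] w(1,2) hc by (auto simp: lift_word_eq_Nil_iff)
    moreover have "reduced (lift_word h c 0 w)" using w(1) hc by (rule reduced_lift_word)
    ultimately show False
      using F[unfolded freiheitssatz_def, rule_format, OF mM(1) _ _ no_z] by blast
  next
    case True
    define h where "h = (\<lambda>g. if g = z then 1 else 0 :: int)"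
    have hr: "word_val h r = 0" using True by (simp add: h_def e_def)
    have hz: "h z \<noteq> 0" "\<And>g. g \<noteq> z \<Longrightarrow> h g = 0" by (simp_all add: h_def)
    let ?s = "lift_word h z 0 r"
    have F: "freiheitssatz ?s" by (rule IH[OF z(1) hz(1) hr])
    obtain m M where mM: "occurs_in (c, m) ?s" "occurs_in (c, M) ?s"
      "\<forall>j. occurs_in (c, j) ?s \<longrightarrow> m \<le> j \<and> j \<le> M"
      by (rule height_bounds[OF z(2,3), of h 0])
    obtain g j where gj: "occurs_in (g, j) ?s" "j \<noteq> m"
      using ex_two_heights[OF r hz hr z, of m] by blast
    \<comment> \<open>lifting from height \<open>m\<close> rather than \<open>0\<close> keeps the heights of \<open>c\<close> in range\<close>
    have height: "l = m" if "occurs_in (x, l) (lift_word h z m w)" for x l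
    proof (rule lift_word_height[OF _ that])
      fix g assume "occurs_in g w"
      then have "g \<noteq> z" using w(3) by blast
      then show "h g = 0" by (rule hz(2))
    qed
    have "m \<le> M" using mM by blast
    have "word_elem (lift_word h z m w) \<in> normal_closure {word_elem ?s}"
    proof (rule lift_word_normal_closure[OF hr F mM(1,2) mM(3)[rule_format] wr])
      show "m \<le> l \<and> l \<le> M" if "occurs_in (c, l) (lift_word h z m w)" for l
        using height[OF that] \<open>m \<le> M\<close> by simp
    qed
    moreover have "lift_word h z m w \<noteq> []"
      using w(2,3) by (cases w) (auto simp: lift_word_eq_Nil_iff occurs_in_def)
    moreover have "reduced (lift_word h z m w)" using w(1) hz(1) by (rule reduced_lift_word)
    moreover have "\<not> occurs_in (g, j) (lift_word h z m w)" using height gj(2) by blast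
    ultimately show False
      using F[unfolded freiheitssatz_def, rule_format, OF gj(1)] by blast
  qed
qed

lemma ex_weight:
  assumes "occurs_in z r" "occurs_in c r" "c \<noteq> z"
  obtains h :: "'a \<Rightarrow> int" and a b where "occurs_in a r" "occurs_in b r" "a \<noteq> b" "h b \<noteq> 0" "word_val h r = 0"
proof -
  define e where "e = (\<lambda>x. word_val (\<lambda>g. if g = x then 1 else 0 :: int) r)"
  show ?thesis
  proof (cases "e z = 0")
    case True
    then show ?thesis using assms that[of c z "\<lambda>g. if g = z then 1 else 0"] by (simp add: e_def)
  next
    case False
    let ?h = "\<lambda>g. e z * (if g = c then 1 else 0) + (- e c) * (if g = z then 1 else 0 :: int)"
    have "word_val ?h r = 0" unfolding word_val_linear by (simp add: e_def)
    then show ?thesis using assms that[of z c ?h] False by simp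
  qed
qed

text \<open>A proper subword that is trivial modulo \<open>r\<close> has weight \<open>0\<close>, and it lifts to a nonempty subword of the lifted
  relator, trivial modulo that relator. It is a proper subword, as otherwise the rest of \<open>r\<close> would
  consist of powers of \<open>b\<close> that cancel cyclically.\<close>

lemma weinbaum_step:
  fixes r :: "'a::countable letter list" and h :: "'a \<Rightarrow> int"
  assumes r: "cyclically_reduced r"
    and ab: "occurs_in a r" "a \<noteq> b" "h b \<noteq> 0" "word_val h r = 0"
    and F: "freiheitssatz (lift_word h b 0 r)" and W: "weinbaum (lift_word h b 0 r)"
  shows "weinbaum r"
  unfolding weinbaum_def
proof (intro allI impI notI)
  fix p u q
  assume eq: "r = p @ u @ q" and ne: "u \<noteq> []" "p @ q \<noteq> []"
    and u: "word_elem u \<in> normal_closure {word_elem r}"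
  let ?s = "lift_word h b 0 r" and ?k = "word_val h p"
  have hu: "word_val h u = 0"
    using free_hom_normal_closure[OF u ab(4)] by (simp add: free_hom_word_elem)
  have s: "?s = lift_word h b 0 p @ lift_word h b ?k u @ lift_word h b ?k q"
    unfolding eq by (simp add: lift_word_append hu)
  obtain m M where mM: "occurs_in (a, m) ?s" "occurs_in (a, M) ?s"
    "\<forall>j. occurs_in (a, j) ?s \<longrightarrow> m \<le> j \<and> j \<le> M"
    by (rule height_bounds[OF ab(1,2), of h 0])
  have "occurs_in (a, j) ?s" if "occurs_in (a, j) (lift_word h b ?k u)" for j
    using that unfolding s by (auto simp: occurs_in_def)
  then have "word_elem (lift_word h b ?k u) \<in> normal_closure {word_elem ?s}"
    by (intro lift_word_normal_closure[OF ab(4) F mM(1,2) mM(3)[rule_format] u] mM(3)[rule_format])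
  moreover have "reduced u" using r eq by (simp add: cyclically_reduced_def reduced_append)
  then have "lift_word h b ?k u \<noteq> []"
    using reduced_one_generator_weight_0[of u b h] hu ab(3) ne(1) by (auto simp: lift_word_eq_Nil_iff)
  ultimately have "lift_word h b 0 p @ lift_word h b ?k q = []"
    using W[unfolded weinbaum_def, rule_format, OF s] by blast
  then have "fst ` set p \<subseteq> {b}" "fst ` set q \<subseteq> {b}" by (simp_all add: lift_word_eq_Nil_iff)
  moreover have "word_val h p + word_val h q = 0" using ab(4) eq hu by simp
  ultimately have "p = []" "q = []"
    using cyclically_reduced_ends[of p u q b h] r eq ab(3) by auto
  then show False using ne(2) by simp
qed

text \<open>Induction on the length: lifting drops all occurrences of \<open>b\<close>. Since a lift is a word over the
  pairs of generators and heights, these are numbered to remain within one type.\<close>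

lemma freiheitssatz_weinbaum_nat:
  fixes r :: "nat letter list"
  assumes "cyclically_reduced r"
  shows "freiheitssatz r \<and> weinbaum r"
  using assms
proof (induction "length r" arbitrary: r rule: less_induct)
  case less
  show ?case
  proof (cases "\<exists>z. fst ` set r \<subseteq> {z}")
    case True
    then obtain z where z: "fst ` set r \<subseteq> {z}" by blast
    have "reduced r" using less.prems by (simp add: cyclically_reduced_def)
    then show ?thesis
      using freiheitssatz_one_generator[OF z] weinbaum_one_generator[OF _ z] by blast
  next
    case False
    have IH: "freiheitssatz (lift_word h b 0 r) \<and> weinbaum (lift_word h b 0 r)"
      if b: "occurs_in b r" "h b \<noteq> 0" "word_val h r = 0" for h :: "nat \<Rightarrow> int" and b
    proof -
      let ?f = "to_nat :: nat \<times> int \<Rightarrow> nat" and ?s = "lift_word h b 0 r"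
      obtain p where "p \<in> set r" "fst p = b" using b(1) by (auto simp: occurs_in_def)
      then have "length (map_word ?f ?s) < length r"
        using length_filter_less[of p r "\<lambda>p. fst p \<noteq> b"] by (simp add: map_word_def length_lift_word)
      moreover have "cyclically_reduced (map_word ?f ?s)"
        using cyclically_reduced_lift_word[OF less.prems b(2,3)] by (simp add: cyclically_reduced_map_word)
      ultimately have "freiheitssatz (map_word ?f ?s) \<and> weinbaum (map_word ?f ?s)"
        by (rule less.hyps)
      then show ?thesis using freiheitssatz_map_word[of ?f] weinbaum_map_word[of ?f] by auto
    qed
    have other: "\<exists>c. occurs_in c r \<and> c \<noteq> z" for z
      using False by (auto simp: occurs_in_def)
    have "freiheitssatz r"
      unfolding freiheitssatz_def
    proof (intro allI impI)
      fix z w assume zw: "occurs_in z r" "reduced w" "w \<noteq> []" "\<not> occurs_in z w"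
      obtain c where "occurs_in c r" "c \<noteq> z" using other by blast
      then show "word_elem w \<notin> normal_closure {word_elem r}"
        using freiheitssatz_step[OF less.prems conjunct1[OF IH] zw(1) _ _ zw(2-4)] by blast
    qed
    moreover have "weinbaum r"
    proof -
      obtain z where z: "occurs_in z r" using other by blast
      obtain c where c: "occurs_in c r" "c \<noteq> z" using other by blast
      obtain h :: "nat \<Rightarrow> int" and a b where
        ab: "occurs_in a r" "occurs_in b r" "a \<noteq> b" "h b \<noteq> 0" "word_val h r = 0"
        by (rule ex_weight[OF z c])
      show ?thesis
        using weinbaum_step[OF less.prems ab(1,3-5)] IH[OF ab(2,4,5)] by blast
    qed
    ultimately show ?thesis by blast
  qed
qed

lemma weinbaum_cyclically_reduced:
  fixes f :: "'a \<Rightarrow> nat" and r :: "'a letter list"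
  assumes "inj f" "cyclically_reduced r"
  shows "weinbaum r"
proof -
  have "cyclically_reduced (map_word f r)"
    using assms by (simp add: cyclically_reduced_map_word)
  then show ?thesis using freiheitssatz_weinbaum_nat weinbaum_map_word by blast
qed

section \<open>The Fox derivative\<close>

text \<open>The rule \<open>D(uv) = D(u) v + \<epsilon>(u) D(v)\<close> puts the remaining suffix to the right of each letter;
  applied to \<open>x\<^bsup>-1\<^esup> x = 1\<close> it forces the value \<open>- x\<^bsup>-1\<^esup>\<close> on an inverse generator.\<close>

definition fox_letter :: "'a \<Rightarrow> 'a letter \<Rightarrow> ('a free_group \<Rightarrow>\<^sub>0 int)" where
  "fox_letter a p = (if fst p \<noteq> a then 0 else if snd p then 1 else - frag_of (- gen a))"

fun fox_word :: "'a \<Rightarrow> 'a letter list \<Rightarrow> ('a free_group \<Rightarrow>\<^sub>0 int)" where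
  "fox_word a [] = 0"
| "fox_word a (p # w) = fox_letter a p * frag_of (word_elem w) + fox_word a w"

lemma frag_of_add: "frag_of (g + h) = frag_of g * frag_of h"
  by (simp add: mult_single)

lemma fox_word_append: "fox_word a (u @ v) = fox_word a u * frag_of (word_elem v) + fox_word a v"
  by (induction u) (simp_all add: word_elem_append frag_of_add algebra_simps)

lemma fox_word_cancel: "fox_word a [p, inv_letter p] = 0"
proof (cases "fst p = a")
  case True
  then consider "p = (a, True)" | "p = (a, False)" by (cases p) auto
  then show ?thesis
    by cases (simp_all add: fox_letter_def inv_letter_def word_elem_letter letter_val_def mult_single)
qed (simp add: fox_letter_def)

lift_definition fox_elem :: "'a \<Rightarrow> 'a free_group \<Rightarrow> ('a free_group \<Rightarrow>\<^sub>0 int)" is fox_word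
proof -
  fix a :: 'a and u v :: "'a letter list"
  have step: "fox_word a u = fox_word a v" if "cancels u v" for u v
    using that
  proof cases
    case (1 s p t)
    have "fox_word a u = fox_word a s * frag_of (word_elem (p # inv_letter p # t)) + fox_word a (p # inv_letter p # t)"
      unfolding 1 by (simp only: fox_word_append append_Cons append_Nil)
    also have "word_elem (p # inv_letter p # t) = word_elem t"
      using word_elem_cancel[of "[]" p t] by simp
    also have "fox_word a (p # inv_letter p # t) = fox_word a t"
      using fox_word_append[of a "[p, inv_letter p]" t] by (simp only: fox_word_cancel append_Cons append_Nil) simp
    also have "fox_word a s * frag_of (word_elem t) + fox_word a t = fox_word a v"
      unfolding 1 by (rule fox_word_append[symmetric])
    finally show ?thesis .
  qed
  assume "equivclp cancels u v"
  then show "fox_word a u = fox_word a v"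
    by (induction rule: equivclp_induct) (auto dest: step)
qed

lemma fox_elem_word_elem: "fox_elem a (word_elem w) = fox_word a w"
  by (rule fox_elem.abs_eq)

lemma fox_elem_add: "fox_elem a (g + h) = fox_elem a g * frag_of h + fox_elem a h"
proof -
  obtain u v where "g = word_elem u" "h = word_elem v" using word_elem_surj by metis
  then show ?thesis
    by (simp only: word_elem_append[symmetric] fox_elem_word_elem fox_word_append)
qed

text \<open>Written as a linear extension, the augmentation inherits additivity.\<close>

lemma augmentation_conv: "augmentation u = Poly_Mapping.lookup (frag_extend (\<lambda>_. frag_of ()) u) ()"
  by (simp add: augmentation_def frag_extend_def lookup_sum)

lemma augmentation_simps [simp]:
  "augmentation 0 = 0" "augmentation (frag_of g) = 1"
  "augmentation (u - v) = augmentation u - augmentation v"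
  by (simp_all add: augmentation_conv frag_extend_diff lookup_minus)

lemma fox_derivation_frag_extend:
  fixes d :: "'g::group_add \<Rightarrow> ('g \<Rightarrow>\<^sub>0 int)"
  assumes "\<And>g h. d (g + h) = d g * frag_of h + d h"
  shows "fox_derivation (frag_extend d)"
  unfolding fox_derivation_def
proof (intro conjI allI)
  show "frag_extend d (u + v) = frag_extend d u + frag_extend d v" for u v
    by (rule frag_extend_add)
  show "frag_extend d (u * v) = frag_extend d u * v + of_int (augmentation u) * frag_extend d v" for u v
    using subset_UNIV[of "Poly_Mapping.keys u"]
  proof (induction u rule: frag_induction)
    case (one g)
    show ?case
      using subset_UNIV[of "Poly_Mapping.keys v"]
    proof (induction v rule: frag_induction)
      case (one h)
      then show ?case by (simp add: frag_of_add[symmetric] assms)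
    next
      case (diff u v)
      then show ?case by (simp add: frag_extend_diff algebra_simps)
    qed simp
  next
    case (diff u u')
    then show ?case by (simp add: frag_extend_diff algebra_simps)
  qed simp
qed

lemma fox_derivation_unique:
  fixes D :: "('a free_group \<Rightarrow>\<^sub>0 int) \<Rightarrow> ('a free_group \<Rightarrow>\<^sub>0 int)"
  assumes D: "fox_derivation D" and gen: "D (frag_of (gen a)) = 1"
    "\<And>b. b \<noteq> a \<Longrightarrow> D (frag_of (gen b)) = 0"
  shows "D = frag_extend (fox_elem a)"
proof
  have add: "D (u + v) = D u + D v" and mult: "D (u * v) = D u * v + of_int (augmentation u) * D v" for u v
    using D by (auto simp: fox_derivation_def)
  have zero: "D 0 = 0" by (rule group_hom_zero) (rule add)
  have diff: "D (u - v) = D u - D v" for u v using add[of "u - v" v] by simp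
  have mult_frag: "D (frag_of (g + h)) = D (frag_of g) * frag_of h + D (frag_of h)" for g h
    unfolding frag_of_add mult by simp
  have one: "D (frag_of 0) = 0" using mult_frag[of 0 0] by simp
  have letter: "D (frag_of (word_elem [p])) = fox_letter a p" for p
  proof (cases "snd p")
    case True
    then show ?thesis using gen by (simp add: word_elem_letter letter_val_def fox_letter_def)
  next
    case False
    let ?g = "gen (fst p)"
    have "D (frag_of (- ?g)) * frag_of ?g = - D (frag_of ?g)"
      using mult_frag[of "- ?g" ?g] one by (simp add: eq_neg_iff_add_eq_0)
    then have "D (frag_of (- ?g)) * frag_of ?g * frag_of (- ?g) = - D (frag_of ?g) * frag_of (- ?g)"
      by simp
    then have "D (frag_of (- ?g)) = - D (frag_of ?g) * frag_of (- ?g)"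
      by (simp add: mult.assoc mult_single)
    then show ?thesis
      using gen False by (auto simp: word_elem_letter letter_val_def fox_letter_def)
  qed
  have word: "D (frag_of (word_elem w)) = fox_word a w" for w
    by (induction w)
       (simp_all only: word_elem_Nil one fox_word.simps, subst word_elem_Cons, simp only: mult_frag letter)
  have elem: "D (frag_of g) = fox_elem a g" for g
    using word_elem_surj[of g] word by (auto simp: fox_elem_word_elem)
  fix u
  show "D u = frag_extend (fox_elem a) u"
    using subset_UNIV[of "Poly_Mapping.keys u"]
    by (induction u rule: frag_induction) (simp_all add: zero elem diff frag_extend_diff)
qed

lemma fox_derivative_frag_of: "fox_derivative a (frag_of g) = fox_elem a g"
proof -
  have gen: "fox_elem a (gen b) = (if b = a then 1 else 0)" for b
    unfolding gen_def fox_elem_word_elem by (simp add: fox_letter_def)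
  have "fox_derivative a = frag_extend (fox_elem a)"
    unfolding fox_derivative_def
  proof (rule the_equality)
    show "fox_derivation (frag_extend (fox_elem a)) \<and> frag_extend (fox_elem a) (frag_of (gen a)) = 1 \<and>
      (\<forall>b. b \<noteq> a \<longrightarrow> frag_extend (fox_elem a) (frag_of (gen b)) = 0)"
      using fox_derivation_frag_extend[of "fox_elem a"] by (simp add: fox_elem_add gen)
  next
    fix D :: "('a free_group \<Rightarrow>\<^sub>0 int) \<Rightarrow> ('a free_group \<Rightarrow>\<^sub>0 int)"
    assume "fox_derivation D \<and> D (frag_of (gen a)) = 1 \<and> (\<forall>b. b \<noteq> a \<longrightarrow> D (frag_of (gen b)) = 0)"
    then show "D = frag_extend (fox_elem a)" by (intro fox_derivation_unique) auto
  qed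
  then show ?thesis by simp
qed

text \<open>Modulo the relator, conjugating it by \<open>g\<close> multiplies its derivative by the unit \<open>g\<^bsup>-1\<^esup>\<close>.\<close>

lemma fox_elem_conjugate:
  "fox_elem a (g + h - g) =
     fox_elem a g * frag_of (- g) * (frag_of (g + h - g) - 1) + fox_elem a h * frag_of (- g)"
proof -
  have "fox_elem a 0 = 0" using fox_elem_word_elem[of a "[]"] by simp
  then have "fox_elem a (- g) = - fox_elem a g * frag_of (- g)"
    using fox_elem_add[of a g "- g"] by (simp add: eq_neg_iff_add_eq_0 add.commute)
  moreover have "fox_elem a (g + h - g) =
      (fox_elem a g * frag_of h + fox_elem a h) * frag_of (- g) + fox_elem a (- g)"
    by (simp only: diff_conv_add_uminus fox_elem_add)
  moreover have "frag_of (- g) * frag_of (g + h - g) = frag_of h * frag_of (- g)"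
    by (simp only: frag_of_add[symmetric] group_normalize)
  ultimately show ?thesis by (simp add: algebra_simps)
qed

section \<open>Reduction modulo the relator\<close>

text \<open>The projection of the group ring of \<open>G\<close> to that of \<open>G/N\<close>, as a map of abelian groups.\<close>

definition coset_sum :: "'g::group_add set \<Rightarrow> ('g \<Rightarrow>\<^sub>0 int) \<Rightarrow> ('g set \<Rightarrow>\<^sub>0 int)" where
  "coset_sum N = frag_extend (\<lambda>g. frag_of (left_coset N g))"

lemma coset_sum_simps [simp]:
  "coset_sum N 0 = 0" "coset_sum N (frag_of g) = frag_of (left_coset N g)"
  "coset_sum N (u + v) = coset_sum N u + coset_sum N v"
  "coset_sum N (u - v) = coset_sum N u - coset_sum N v"
  "coset_sum N (- u) = - coset_sum N u"
  by (simp_all add: coset_sum_def frag_extend_add frag_extend_diff frag_extend_minus)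

lemma coset_sum_mult_relator:
  assumes "h \<in> normal_closure S"
  shows "coset_sum (normal_closure S) (u * (frag_of h - 1)) = 0"
  using subset_UNIV[of "Poly_Mapping.keys u"]
proof (induction u rule: frag_induction)
  case (one g)
  have "left_coset (normal_closure S) g = left_coset (normal_closure S) (g + h)"
    unfolding left_coset_eq_iff using assms by simp
  then show ?case by (simp add: right_diff_distrib frag_of_add[symmetric])
qed (simp_all add: left_diff_distrib)

lemma coset_sum_ideal:
  assumes "v \<in> relative_augmentation_ideal (normal_closure S)"
  shows "coset_sum (normal_closure S) v = 0"
proof -
  obtain k :: nat and u h where v: "v = (\<Sum>i<k. u i * (frag_of (h i) - 1))"
    and h: "\<forall>i<k. h i \<in> normal_closure S"
    using assms by (auto simp: relative_augmentation_ideal_def)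
  show ?thesis
    unfolding v using h by (induction k) (simp_all add: coset_sum_mult_relator)
qed

lemma mult_relator_in_ideal:
  assumes "h \<in> R"
  shows "u * (frag_of h - 1) \<in> relative_augmentation_ideal R"
proof -
  have "u * (frag_of h - 1) = (\<Sum>i<Suc 0. (\<lambda>_. u) i * (frag_of ((\<lambda>_. h) i) - 1))" by simp
  then show ?thesis unfolding relative_augmentation_ideal_def using assms
    by (intro CollectI exI[of _ "Suc 0"] exI[of _ "\<lambda>_. u"] exI[of _ "\<lambda>_. h"]) simp
qed

lemma coset_sum_mult_right:
  "coset_sum (normal_closure S) (u * frag_of k) =
     frag_extend (\<lambda>C. frag_of ((\<lambda>x. x + k) ` C)) (coset_sum (normal_closure S) u)"
  using subset_UNIV[of "Poly_Mapping.keys u"]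
proof (induction u rule: frag_induction)
  case (one g)
  have "left_coset (normal_closure S) (g + k) = (\<lambda>x. x + k) ` left_coset (normal_closure S) g"
  proof (intro set_eqI iffI)
    fix y assume "y \<in> left_coset (normal_closure S) (g + k)"
    then have "- (g + k) + y \<in> normal_closure S" by (simp add: left_coset_def)
    from normal_closure.conjugate[OF this, of k]
    have "- g + (y - k) \<in> normal_closure S" by (simp only: group_normalize)
    then show "y \<in> (\<lambda>x. x + k) ` left_coset (normal_closure S) g"
      by (intro image_eqI[of _ _ "y - k"]) (simp_all add: left_coset_def)
  next
    fix y assume "y \<in> (\<lambda>x. x + k) ` left_coset (normal_closure S) g"
    then obtain x where "- g + x \<in> normal_closure S" "y = x + k" by (auto simp: left_coset_def)
    then show "y \<in> left_coset (normal_closure S) (g + k)"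
      using normal_closure.conjugate[of "- g + x" S "- k"]
      by (simp only: left_coset_def mem_Collect_eq group_normalize)
  qed
  then show ?case by (simp add: frag_of_add[symmetric])
qed (simp_all add: left_diff_distrib frag_extend_diff)

text \<open>The signed suffixes whose sum is the Fox derivative: a letter \<open>a\<close> contributes the suffix after it,
  a letter \<open>a\<^bsup>-1\<^esup>\<close> contributes, negatively, the suffix that it starts.\<close>

fun fox_terms :: "'a \<Rightarrow> 'a letter list \<Rightarrow> (bool \<times> 'a letter list) list" where
  "fox_terms a [] = []"
| "fox_terms a (p # w) =
     (if fst p \<noteq> a then [] else if snd p then [(True, w)] else [(False, p # w)]) @ fox_terms a w"

lemma lookup_coset_sum_fox_word:
  "Poly_Mapping.lookup (coset_sum N (fox_word a w)) C =
     (\<Sum>t\<leftarrow>fox_terms a w. if left_coset N (word_elem (snd t)) = C then if fst t then 1 else - 1 else 0)"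
proof (induction w)
  case (Cons p w)
  have "word_elem (p # w) = - gen a + word_elem w" if "fst p = a" "\<not> snd p"
    by (subst word_elem_Cons) (simp add: that word_elem_letter letter_val_def)
  then show ?case
    using Cons by (auto simp: fox_letter_def lookup_add frag_of_add[symmetric])
qed simp

lemma fox_terms_True: "(True, q) \<in> set (fox_terms a w) \<Longrightarrow> \<exists>p. w = p @ (a, True) # q"
proof (induction w)
  case (Cons p w)
  show ?case
  proof (cases "(True, q) \<in> set (fox_terms a w)")
    case True
    then show ?thesis using Cons.IH by (metis append_Cons)
  next
    case False
    then have "p # w = [] @ (a, True) # q"
      using Cons.prems by (cases p) (auto split: if_splits)
    then show ?thesis by blast
  qed
qed simp

lemma fox_terms_False:
  "(False, v) \<in> set (fox_terms a w) \<Longrightarrow> \<exists>p q. w = p @ v \<and> v = (a, False) # q"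
proof (induction w)
  case (Cons p w)
  show ?case
  proof (cases "(False, v) \<in> set (fox_terms a w)")
    case True
    then show ?thesis using Cons.IH by (metis append_Cons)
  next
    case False
    then have "p # w = [] @ v \<and> v = (a, False) # w"
      using Cons.prems by (cases p) (auto split: if_splits)
    then show ?thesis by blast
  qed
qed simp

lemma fox_terms_eq_Nil_iff: "fox_terms a w = [] \<longleftrightarrow> \<not> occurs_in a w"
  by (induction w) (auto simp: occurs_in_def)

lemma fox_word_eq_0: "\<not> occurs_in a w \<Longrightarrow> fox_word a w = 0"
  by (induction w) (auto simp: occurs_in_def fox_letter_def)

text \<open>If two suffixes of opposite sign agree modulo the relator, then the subword \<open>u\<close> by which they differ is
  trivial there, so it is empty or the whole word. If it is empty, a letter \<open>a\<close> is followed by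
  \<open>a\<^bsup>-1\<^esup>\<close>; if it is the whole word, the word starts with \<open>a\<^bsup>-1\<^esup>\<close> and ends with \<open>a\<close>. Both contradict
  cyclic reducedness.\<close>

lemma fox_terms_opposite_signs:
  assumes w: "cyclically_reduced w" and W: "weinbaum w"
    and "(True, q) \<in> set (fox_terms a w)" "(False, v) \<in> set (fox_terms a w)"
  shows "- word_elem q + word_elem v \<notin> normal_closure {word_elem w}"
proof
  let ?N = "normal_closure {word_elem w}"
  assume qv: "- word_elem q + word_elem v \<in> ?N"
  obtain p1 where p1: "w = (p1 @ [(a, True)]) @ q" using fox_terms_True[OF assms(3)] by auto
  obtain p2 v' where p2: "w = p2 @ v" and v: "v = (a, False) # v'"
    using fox_terms_False[OF assms(4)] by blast
  have inv: "(a, False) = inv_letter (a, True)" by (simp add: inv_letter_def)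
  have red: "reduced w" using w by (simp add: cyclically_reduced_def)
  have not_adjacent: "w \<noteq> (p1 @ [(a, True)]) @ v"
    using red by (auto simp: v reduced_append reduced_Cons inv)
  from p1 p2 have "(p1 @ [(a, True)]) @ q = p2 @ v" by simp
  then consider u where "p1 @ [(a, True)] = p2 @ u" "u @ q = v"
    | u where "(p1 @ [(a, True)]) @ u = p2" "q = u @ v"
    unfolding append_eq_append_conv2 by blast
  then show False
  proof cases
    case 1
    have "u \<noteq> []" using 1 not_adjacent p1 by auto
    have "- word_elem q + (word_elem u + word_elem q) \<in> ?N"
      using qv by (simp only: 1(2)[symmetric] word_elem_append)
    from normal_closure.conjugate[OF this, of "word_elem q"]
    have u: "word_elem u \<in> ?N" by (simp only: group_normalize)
    have "w = p2 @ u @ q" using p2 1(2) by simp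
    then have "p2 @ q = []" using W u \<open>u \<noteq> []\<close> unfolding weinbaum_def by metis
    then have "w = v" "w = p1 @ [(a, True)]" using p2 p1 by auto
    then have "hd w = (a, False)" "last w = (a, True)" "w \<noteq> []"
      by (simp add: v, (metis last_snoc snoc_eq_iff_butlast)+)
    then show False using w inv by (simp add: cyclically_reduced_def)
  next
    case 2
    have "u \<noteq> []" using 2 not_adjacent p1 by auto
    have "- (word_elem u + word_elem v) + word_elem v \<in> ?N"
      using qv by (simp only: 2(2) word_elem_append)
    from normal_closure.conjugate[OF normal_closure.uminus[OF this], of "word_elem v"]
    have "word_elem u \<in> ?N" by (simp only: group_normalize)
    moreover have "w = (p1 @ [(a, True)]) @ u @ v" using p1 2(2) by simp
    ultimately show False
      using W[unfolded weinbaum_def, rule_format, of "p1 @ [(a, True)]" u v] \<open>u \<noteq> []\<close> by simp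
  qed
qed

text \<open>Terms in the same coset all have the same sign, so nothing cancels.\<close>

lemma coset_sum_fox_word_nonzero:
  assumes w: "cyclically_reduced w" and W: "weinbaum w" and a: "occurs_in a w"
  shows "coset_sum (normal_closure {word_elem w}) (fox_word a w) \<noteq> 0"
proof
  let ?N = "normal_closure {word_elem w}"
  let ?c = "\<lambda>t. left_coset ?N (word_elem (snd t))"
  obtain t where t: "t \<in> set (fox_terms a w)"
    using a by (metis fox_terms_eq_Nil_iff list.set_sel(1))
  have same: "fst t' = fst t" if t': "t' \<in> set (fox_terms a w)" "?c t' = ?c t" for t'
  proof (rule ccontr)
    assume ne: "fst t' \<noteq> fst t"
    show False
    proof (cases "fst t")
      case True
      then have "(True, snd t) \<in> set (fox_terms a w)" "(False, snd t') \<in> set (fox_terms a w)"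
        using t t' ne by (cases t; cases t'; simp)+
      from fox_terms_opposite_signs[OF w W this] t'(2)[symmetric] show False
        by (simp add: left_coset_eq_iff)
    next
      case False
      then have "(True, snd t') \<in> set (fox_terms a w)" "(False, snd t) \<in> set (fox_terms a w)"
        using t t' ne by (cases t; cases t'; simp)+
      from fox_terms_opposite_signs[OF w W this] t'(2) show False
        by (simp add: left_coset_eq_iff)
    qed
  qed
  let ?f = "\<lambda>t'. if ?c t' = ?c t then if fst t' then 1 else - 1 else 0 :: int"
  let ?e = "if fst t then 1 else - 1 :: int"
  have "(\<Sum>t'\<leftarrow>fox_terms a w. ?f t') = (\<Sum>t'\<leftarrow>fox_terms a w. if ?c t' = ?c t then ?e else 0)"
    by (intro arg_cong[of _ _ sum_list] map_cong refl) (auto simp: same)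
  also have "(\<Sum>t'\<leftarrow>ts. if ?c t' = ?c t then ?e else 0) =
      ?e * int (length (filter (\<lambda>t'. ?c t' = ?c t) ts))" for ts
    by (induction ts) (simp_all add: algebra_simps)
  finally have sum: "(\<Sum>t'\<leftarrow>fox_terms a w. ?f t') =
      ?e * int (length (filter (\<lambda>t'. ?c t' = ?c t) (fox_terms a w)))" .
  assume "coset_sum ?N (fox_word a w) = 0"
  then have "(\<Sum>t'\<leftarrow>fox_terms a w. ?f t') = 0"
    using lookup_coset_sum_fox_word[of ?N a w "?c t"] by simp
  then have "filter (\<lambda>t'. ?c t' = ?c t) (fox_terms a w) = []"
    unfolding sum by (simp split: if_splits)
  then show False using t by (auto simp: filter_empty_conv)
qed

lemma fox_elem_conjugate_in_ideal_iff:
  fixes f :: "'a \<Rightarrow> nat" and w :: "'a letter list"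
  assumes "inj f" "cyclically_reduced w"
  shows "fox_elem a (g + word_elem w - g) \<in>
      relative_augmentation_ideal (normal_closure {g + word_elem w - g}) \<longleftrightarrow> \<not> occurs_in a w"
proof -
  let ?h = "word_elem w" and ?N = "normal_closure {word_elem w}"
  have gh: "g + ?h - g \<in> ?N" by (intro normal_closure.conjugate normal_closure.base) simp
  have "fox_elem a (g + ?h - g) \<notin> relative_augmentation_ideal ?N" if "occurs_in a w"
  proof
    assume "fox_elem a (g + ?h - g) \<in> relative_augmentation_ideal ?N"
    from coset_sum_ideal[OF this] have "coset_sum ?N (fox_elem a ?h * frag_of (- g)) = 0"
      unfolding fox_elem_conjugate using coset_sum_mult_relator[OF gh] by simp
    then have "coset_sum ?N (fox_elem a ?h * frag_of (- g) * frag_of g) = 0"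
      unfolding coset_sum_mult_right[of _ "fox_elem a ?h * frag_of (- g)"] by simp
    then have "coset_sum ?N (fox_word a w) = 0"
      by (simp add: mult.assoc frag_of_add[symmetric] fox_elem_word_elem)
    then show False
      using coset_sum_fox_word_nonzero[OF assms(2) weinbaum_cyclically_reduced[OF assms] that] by blast
  qed
  moreover have "fox_elem a (g + ?h - g) \<in> relative_augmentation_ideal ?N" if "\<not> occurs_in a w"
  proof -
    have "fox_elem a ?h = 0" using that by (simp add: fox_elem_word_elem fox_word_eq_0)
    then show ?thesis unfolding fox_elem_conjugate[of a g ?h] using mult_relator_in_ideal[OF gh] by simp
  qed
  ultimately show ?thesis unfolding normal_closure_conjugate by blast
qed

theorem mainTheorem3:
  fixes n :: nat and x :: "nat \<Rightarrow> 'a" and r :: "'a free_group"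
  assumes "bij_betw x {1..n} (UNIV :: 'a set)"
  shows "(\<forall>w. cyclically_reduced w \<and> r = word_elem w \<longrightarrow>
            (occurs_in (x n) w \<longleftrightarrow>
             fox_derivative (x n) (frag_of r) \<notin> relative_augmentation_ideal (normal_closure {r})))
       \<and> ((\<exists>w g. cyclically_reduced w \<and> r = g + word_elem w - g \<and> occurs_in (x n) w) \<longleftrightarrow>
             fox_derivative (x n) (frag_of r) \<notin> relative_augmentation_ideal (normal_closure {r}))"
proof -
  have "inj (inv_into {1..n} x)"
    using assms by (metis bij_betw_inv_into bij_betw_imp_inj_on)
  then have iff: "fox_derivative (x n) (frag_of r) \<in> relative_augmentation_ideal (normal_closure {r})
      \<longleftrightarrow> \<not> occurs_in (x n) w"
    if "cyclically_reduced w" "r = g + word_elem w - g" for w g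
    using fox_elem_conjugate_in_ideal_iff[of _ w "x n" g] that
    unfolding fox_derivative_frag_of by blast
  have "r = 0 + word_elem w - 0" if "r = word_elem w" for w using that by simp
  then have "\<forall>w. cyclically_reduced w \<and> r = word_elem w \<longrightarrow>
            (occurs_in (x n) w \<longleftrightarrow>
             fox_derivative (x n) (frag_of r) \<notin> relative_augmentation_ideal (normal_closure {r}))"
    using iff by blast
  moreover obtain w g where "cyclically_reduced w" "r = g + word_elem w - g"
    using cyclically_reduced_conjugate word_elem_surj[of r] by metis
  ultimately show ?thesis using iff by blast
qed

end
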